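(* Suppose $n>k\geq\ell\geq t\geq 1$ and $q\geq 2$ are integers. The following hold. (i) Suppose $n\geq t+2e(k-t)k/q$. If $\mathcal{F}\subseteq\mathcal{S}_{n,k,q}$ is $t$-intersecting, then $|\mathcal{F}|\leq\binom{n-t}{k-t}q^{k-t}$, with equality if and only if $\mathcal{F}=\{(A,f)\in\mathcal{S}_{n,k,q}:X\subseteq A,\ f|_X=f_0\}$ for some $X\in\binom{[n]}{t}$ and $f_0:X\to[q]$. (ii) Suppose $n\geq t+2e\cdot\max\{(t+2)^2(k-t),\,k^2\}/q$. If $\mathcal{F}\subseteq\mathcal{S}_{n,k,q}$ and $\mathcal{G}\subseteq\mathcal{S}_{n,\ell,q}$ are cross $t$-intersecting, then $|\mathcal{F}||\mathcal{G}|\leq\binom{n-t}{k-t}\binom{n-t}{\ell-t}q^{k+\ell-2t}$, with equality if and only if $\mathcal{F}=\{(A,f)\in\mathcal{S}_{n,k,q}:X\subseteq A,\ f|_X=f_0\}$ and $\mathcal{G}=\{(B,g)\in\mathcal{S}_{n,\ell,q}:X\subseteq B,\ g|_X=f_0\}$ for some $X\in\binom{[n]}{t}$ and $f_0:X\to[q]$.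
   Context: $[n]=\{1,\dots,n\}$, $\binom{[n]}{k}$ is the family of all $k$-subsets of $[n]$, and $e$ is the base of the natural logarithm. A $q$-signed $k$-set on $[n]$ is a pair $(A,f)$ with $A\in\binom{[n]}{k}$ and $f:A\to[q]$ a function; $\mathcal{S}_{n,k,q}$ is the set of all such pairs. A family $\mathcal{F}\subseteq\mathcal{S}_{n,k,q}$ is $t$-intersecting if for all $(A,f),(B,g)\in\mathcal{F}$ there are at least $t$ elements of $A\cap B$ on which $f$ and $g$ agree. Families $\mathcal{F}\subseteq\mathcal{S}_{n,k,q}$ and $\mathcal{G}\subseteq\mathcal{S}_{n,\ell,q}$ are cross $t$-intersecting if for all $(A,f)\in\mathcal{F}$ and $(B,g)\in\mathcal{G}$ there are at least $t$ elements of $A\cap B$ on which $f$ and $g$ agree. *)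

theory Defs
  imports Complex_Main "HOL-Library.FuncSet"
begin

type_synonym signed_set = "nat set \<times> (nat \<Rightarrow> nat)"

text \<open>
  A function from \<open>A\<close> to \<open>[q]\<close> is an element of \<open>A \<rightarrow>\<^sub>E {1..q}\<close>, so it takes the value
  \<open>undefined\<close> outside \<open>A\<close>. Hence each signed set has exactly one representation as a pair,
  and cardinalities of families are the intended ones.
\<close>

definition signed_sets :: "nat \<Rightarrow> nat \<Rightarrow> nat \<Rightarrow> signed_set set" where
  "signed_sets n k q = {(A, f). A \<subseteq> {1..n} \<and> card A = k \<and> f \<in> A \<rightarrow>\<^sub>E {1..q}}"

definition t_intersecting :: "nat \<Rightarrow> signed_set set \<Rightarrow> bool" where
  "t_intersecting t \<F> \<longleftrightarrow>
     (\<forall>(A, f) \<in> \<F>. \<forall>(B, g) \<in> \<F>. card {x \<in> A \<inter> B. f x = g x} \<ge> t)"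

definition cross_t_intersecting :: "nat \<Rightarrow> signed_set set \<Rightarrow> signed_set set \<Rightarrow> bool" where
  "cross_t_intersecting t \<F> \<G> \<longleftrightarrow>
     (\<forall>(A, f) \<in> \<F>. \<forall>(B, g) \<in> \<G>. card {x \<in> A \<inter> B. f x = g x} \<ge> t)"

end

theory Submission
  imports Defs "HOL-Combinatorics.Transposition"
begin

text \<open>
  Both parts follow from the cross version under the weaker hypothesis
  \<open>2 e (k - t) k \<le> (n - t) q\<close>, which says that prescribing one more element of a signed set
  beyond \<open>t\<close> costs a factor of at most \<open>\<rho> = 1 / (2 e k)\<close>. Shifting values to 1 makes any two
  members share at least \<open>t\<close> positions where both are 1, and shifting positions then makes the
  families of 1-sets shifted. For shifted cross \<open>t\<close>-intersecting families Frankl's walk argument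
  gives, for all \<open>A\<close>, \<open>B\<close>, some \<open>i\<close> with \<open>|A \<inter> [i]| + |B \<inter> [i]| \<ge> i + t\<close>, so the families are
  covered by few stars. Since \<open>(p choose s) \<rho> ^ s \<le> e ^ (- s) / s!\<close> for \<open>p \<le> 2 k\<close>, the cover has
  total size governed by \<open>exp (1 / e) \<le> 1.56\<close>, which is small enough to force a strict inequality
  unless both families lie in one star. Uniqueness is carried back through each shift: if the shifted
  families are full stars, the original ones are these stars or their images under the swap, because
  any two members of a star have a common third one agreeing with both of them only in the centre.
\<close>

section \<open>Shifting along an involution\<close>

text \<open>Both inductions over shifts carry one alternative: the product of the sizes is strictly
  smaller than for two stars, or the families are full stars with a common centre. A shift preserves
  sizes, so the strict alternative passes back for free and all the work of uniqueness concerns the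
  other one; this is why the walk estimates aim at strict inequalities. The constant 2 e has two
  sources. A walk of a set of size at most \<open>K\<close> that meets the line y = x + v at height
  v + j does so after v + 2 j \<le> 2 K steps, so at most (2 K)^s / s! sets of s positions come into
  play. The additional e turns the resulting exponential series from exp 1 into exp (1 / e), small
  enough for the products that must stay below 1. When q = 2, the obstacle in uniqueness is that two
  members of a star may take both values at one position, so a third member has to vanish there; the
  range of n leaves enough other positions for it.\<close>

definition shift :: "('a \<Rightarrow> 'a) \<Rightarrow> ('a \<Rightarrow> bool) \<Rightarrow> 'a set \<Rightarrow> 'a set" where
  "shift \<sigma> mov F = {h \<in> F. mov h \<longrightarrow> \<sigma> h \<in> F} \<union> \<sigma> ` {h \<in> F. mov h \<and> \<sigma> h \<notin> F}"

text \<open>Only members whose image is absent from \<open>F\<close> are moved, and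
  \<open>\<sigma>\<close> is injective, so the kept and the moved part are disjoint and nothing is
  merged. With constant weight 1 this gives preservation of size.\<close>

lemma sum_shift:
  fixes w :: "'a \<Rightarrow> nat"
  assumes "finite F" "\<And>h. \<sigma> (\<sigma> h) = h"
  shows "sum w (shift \<sigma> mov F) =
    sum w {h \<in> F. mov h \<longrightarrow> \<sigma> h \<in> F} + (\<Sum>h | h \<in> F \<and> mov h \<and> \<sigma> h \<notin> F. w (\<sigma> h))"
proof -
  have "inj \<sigma>"
    by (metis assms(2) injI)
  then have "inj_on \<sigma> B" for B
    by (rule inj_on_subset) simp
  then show ?thesis
    unfolding shift_def using assms
    by (subst sum.union_disjoint) (auto simp: sum.reindex)
qed

lemma sum_split_shift:
  fixes w :: "'a \<Rightarrow> nat"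
  assumes "finite F"
  shows "sum w F =
    sum w {h \<in> F. mov h \<longrightarrow> \<sigma> h \<in> F} + sum w {h \<in> F. mov h \<and> \<sigma> h \<notin> F}"
  by (subst sum.union_disjoint[symmetric]) (use assms in \<open>auto intro: sum.cong\<close>)

lemma card_shift:
  assumes "finite F" "\<And>h. \<sigma> (\<sigma> h) = h"
  shows "card (shift \<sigma> mov F) = card F"
  using sum_shift[OF assms, of "\<lambda>_. 1" mov] sum_split_shift[OF assms(1), of "\<lambda>_. 1" mov \<sigma>]
  by simp

text \<open>A weight that drops on every movable member measures progress: the total falls strictly
  as soon as one member really moves, which makes repeated shifting terminate.\<close>

lemma sum_shift_le:
  fixes w :: "'a \<Rightarrow> nat"
  assumes "finite F" "\<And>h. \<sigma> (\<sigma> h) = h" "\<And>h. h \<in> F \<Longrightarrow> mov h \<Longrightarrow> w (\<sigma> h) < w h"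
  shows "sum w (shift \<sigma> mov F) \<le> sum w F"
    and "h \<in> F \<Longrightarrow> mov h \<Longrightarrow> \<sigma> h \<notin> F \<Longrightarrow> sum w (shift \<sigma> mov F) < sum w F"
proof -
  show "sum w (shift \<sigma> mov F) \<le> sum w F"
    unfolding sum_shift[OF assms(1,2)] sum_split_shift[OF assms(1), of w mov \<sigma>]
    by (intro add_left_mono sum_mono less_imp_le assms(3)) auto
  show "sum w (shift \<sigma> mov F) < sum w F" if "h \<in> F" "mov h" "\<sigma> h \<notin> F"
    unfolding sum_shift[OF assms(1,2)] sum_split_shift[OF assms(1), of w mov \<sigma>]
    by (intro add_strict_left_mono sum_strict_mono assms(3)) (use that assms(1) in auto)
qed

lemma shift_subset: "F \<subseteq> H \<Longrightarrow> (\<And>h. h \<in> H \<Longrightarrow> mov h \<Longrightarrow> \<sigma> h \<in> H) \<Longrightarrow> shift \<sigma> mov F \<subseteq> H"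
  by (auto simp: shift_def)

text \<open>If both members were moved, \<open>adj\<close> undoes the two moves together. If only
  one was moved, the other was either immovable, which \<open>mono\<close> covers, or kept because
  its image was present too; then \<open>adj\<close> transfers the relation from that image.\<close>

lemma shift_cross:
  assumes cross: "\<And>h g. h \<in> F \<Longrightarrow> g \<in> G \<Longrightarrow> R h g"
    and inv: "\<And>h. \<sigma> (\<sigma> h) = h"
    and adj: "\<And>h g. R (\<sigma> h) g \<longleftrightarrow> R h (\<sigma> g)"
    and mono: "\<And>h g. h \<in> F \<Longrightarrow> g \<in> G \<Longrightarrow> mov h \<Longrightarrow> \<not> mov g \<Longrightarrow> R h g \<Longrightarrow> R (\<sigma> h) g"
      "\<And>h g. h \<in> F \<Longrightarrow> g \<in> G \<Longrightarrow> \<not> mov h \<Longrightarrow> mov g \<Longrightarrow> R h g \<Longrightarrow> R h (\<sigma> g)"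
    and "h \<in> shift \<sigma> mov F" "g \<in> shift \<sigma> mov G"
  shows "R h g"
proof -
  consider "h \<in> F" "mov h \<longrightarrow> \<sigma> h \<in> F" | h' where "h = \<sigma> h'" "h' \<in> F" "mov h'"
    using assms(6) unfolding shift_def by blast
  then show ?thesis
  proof cases
    case h: 1
    consider "g \<in> G" | g' where "g = \<sigma> g'" "g' \<in> G" "mov g'"
      using assms(7) unfolding shift_def by blast
    then show ?thesis
      by cases (use h cross adj mono(2) in metis)+
  next
    case h: 2
    consider "g \<in> G" "mov g \<longrightarrow> \<sigma> g \<in> G" | g' where "g = \<sigma> g'" "g' \<in> G" "mov g'"
      using assms(7) unfolding shift_def by blast
    then show ?thesis
      by cases (use h cross adj mono(1) inv in metis)+
  qed
qed

text \<open>Induction on the total weight: \<open>Q\<close> is the invariant of the pair,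
  \<open>P\<close> the conclusion that is pulled back through a single shift, and
  \<open>base\<close> the case where both families are closed under every shift. It serves both for
  value flips and for position swaps.\<close>

lemma shift_induct:
  fixes w :: "'a \<Rightarrow> nat" and \<sigma> :: "'s \<Rightarrow> 'a \<Rightarrow> 'a"
  assumes "Q F G"
    and fin: "\<And>F G. Q F G \<Longrightarrow> finite F \<and> finite G"
    and inv: "\<And>s h. s \<in> I \<Longrightarrow> \<sigma> s (\<sigma> s h) = h"
    and w: "\<And>F G s h. Q F G \<Longrightarrow> s \<in> I \<Longrightarrow> h \<in> F \<union> G \<Longrightarrow> mov s h \<Longrightarrow> w (\<sigma> s h) < w h"
    and step: "\<And>F G s. Q F G \<Longrightarrow> s \<in> I \<Longrightarrow> Q (shift (\<sigma> s) (mov s) F) (shift (\<sigma> s) (mov s) G)"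
    and pull: "\<And>F G s. Q F G \<Longrightarrow> s \<in> I \<Longrightarrow>
      P (shift (\<sigma> s) (mov s) F) (shift (\<sigma> s) (mov s) G) \<Longrightarrow> P F G"
    and base: "\<And>F G. Q F G \<Longrightarrow> (\<And>s h. s \<in> I \<Longrightarrow> h \<in> F \<Longrightarrow> mov s h \<Longrightarrow> \<sigma> s h \<in> F) \<Longrightarrow>
      (\<And>s h. s \<in> I \<Longrightarrow> h \<in> G \<Longrightarrow> mov s h \<Longrightarrow> \<sigma> s h \<in> G) \<Longrightarrow> P F G"
  shows "P F G"
  using \<open>Q F G\<close>
proof (induction "sum w F + sum w G" arbitrary: F G rule: less_induct)
  case less
  show ?case
  proof (cases "\<exists>s\<in>I. \<exists>h. mov s h \<and> (h \<in> F \<and> \<sigma> s h \<notin> F \<or> h \<in> G \<and> \<sigma> s h \<notin> G)")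
    case False
    then show ?thesis
      by (intro base less.prems) blast+
  next
    case True
    then obtain s h where s: "s \<in> I" "mov s h" "h \<in> F \<and> \<sigma> s h \<notin> F \<or> h \<in> G \<and> \<sigma> s h \<notin> G"
      by blast
    have wF: "\<And>h. h \<in> F \<Longrightarrow> mov s h \<Longrightarrow> w (\<sigma> s h) < w h"
      and wG: "\<And>h. h \<in> G \<Longrightarrow> mov s h \<Longrightarrow> w (\<sigma> s h) < w h"
      using w[OF less.prems s(1)] by auto
    have fF: "finite F" and fG: "finite G"
      using fin[OF less.prems] by auto
    note F = sum_shift_le[where \<sigma> = "\<sigma> s" and mov = "mov s" and w = w, OF fF inv[OF s(1)] wF]
    note G = sum_shift_le[where \<sigma> = "\<sigma> s" and mov = "mov s" and w = w, OF fG inv[OF s(1)] wG]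
    have "sum w (shift (\<sigma> s) (mov s) F) + sum w (shift (\<sigma> s) (mov s) G) < sum w F + sum w G"
      using s(2,3)
    proof (elim disjE conjE)
      assume "h \<in> F" "\<sigma> s h \<notin> F"
      then show ?thesis
        using F(2)[of h] G(1) s(2) by linarith
    next
      assume "h \<in> G" "\<sigma> s h \<notin> G"
      then show ?thesis
        using G(2)[of h] F(1) s(2) by linarith
    qed
    then show ?thesis
      using less.hyps step[OF less.prems s(1)] pull[OF less.prems s(1)] by blast
  qed
qed

text \<open>A member of \<open>S\<close> that had arrived by a move would have its source in
  \<open>S\<close> as well, because \<open>S\<close> is closed under the reverse move; but a source
  that has moved is no longer in the shifted family. Hence nothing moved.\<close>

lemma shift_eq_trivial:
  assumes "finite F" "\<And>h. \<sigma> (\<sigma> h) = h" "\<forall>h. mov h \<longrightarrow> \<not> mov (\<sigma> h)"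
    and "shift \<sigma> mov F = S" "\<And>h. h \<in> S \<Longrightarrow> mov (\<sigma> h) \<Longrightarrow> \<sigma> h \<in> S"
  shows "F = S"
proof -
  have "h \<in> F" if h: "h \<in> S" for h
  proof (rule ccontr)
    assume "h \<notin> F"
    then obtain h' where h': "h = \<sigma> h'" "h' \<in> F" "mov h'" "\<sigma> h' \<notin> F"
      using h assms(4) unfolding shift_def by blast
    have "h' \<in> shift \<sigma> mov F"
      using assms(5)[OF h] h' assms(2,4) by metis
    then show False
      using h' assms(2,3) unfolding shift_def by fastforce
  qed
  then show ?thesis
    using card_shift[OF assms(1,2)] assms(1,4) by (metis card_subset_eq subsetI)
qed

text \<open>Members of \<open>S\<close> whose image is also in \<open>S\<close> must belong to
  \<open>F\<close>, so what remains open is one binary choice for each \<open>h\<close> in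
  \<open>S\<close> with \<open>\<sigma> h\<close> outside \<open>S\<close>. The last two claims are
  the two constant choices, closed off by comparing sizes.\<close>

lemma shift_eq_split:
  assumes "finite F" "\<And>h. \<sigma> (\<sigma> h) = h" "\<forall>h. mov h \<longrightarrow> \<not> mov (\<sigma> h)"
    and "shift \<sigma> mov F = S"
  shows "h \<in> S \<Longrightarrow> h \<in> F \<or> \<sigma> h \<in> F"
    and "(\<And>h. h \<in> S \<Longrightarrow> \<sigma> h \<notin> S \<Longrightarrow> h \<in> F) \<Longrightarrow> F = S"
    and "(\<And>h. h \<in> S \<Longrightarrow> \<sigma> h \<notin> S \<Longrightarrow> \<sigma> h \<in> F) \<Longrightarrow> F = \<sigma> ` S"
proof -
  show "h \<in> S \<Longrightarrow> h \<in> F \<or> \<sigma> h \<in> F"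
    using assms(2,4) unfolding shift_def by auto
  have both: "h \<in> F" if h: "h \<in> S" "\<sigma> h \<in> S" for h
  proof (rule ccontr)
    assume "h \<notin> F"
    then obtain h' where h': "h = \<sigma> h'" "h' \<in> F" "mov h'" "\<sigma> h' \<notin> F"
      using h assms(4) unfolding shift_def by blast
    have "h' \<in> shift \<sigma> mov F"
      using h' assms(2,4) h by metis
    then show False
      using h' assms(2,3) unfolding shift_def by fastforce
  qed
  have card: "card F = card S"
    using card_shift[OF assms(1,2)] assms(4) by metis
  show "F = S" if "\<And>h. h \<in> S \<Longrightarrow> \<sigma> h \<notin> S \<Longrightarrow> h \<in> F"
    using that both card assms(1) by (metis card_subset_eq subsetI)
  show "F = \<sigma> ` S" if *: "\<And>h. h \<in> S \<Longrightarrow> \<sigma> h \<notin> S \<Longrightarrow> \<sigma> h \<in> F"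
  proof -
    have "\<sigma> ` S \<subseteq> F"
      using * both assms(2) by (smt (verit) image_subsetI)
    moreover have "card (\<sigma> ` S) = card F"
      using card assms(2) by (metis card_image inj_onI)
    ultimately show ?thesis
      using assms(1) by (metis card_subset_eq)
  qed
qed

text \<open>
  Each \<open>h\<close> in \<open>S\<close> with \<open>\<sigma> h \<notin> S\<close> comes either from \<open>h\<close> or from \<open>\<sigma> h\<close>. If \<open>R h (\<sigma> g)\<close> fails,
  then \<open>h\<close> and \<open>g\<close> make the same choice, so the last two assumptions force one global choice.
\<close>

lemma shift_eq_back:
  assumes fin: "finite F" "finite G" and inv: "\<And>h. \<sigma> (\<sigma> h) = h"
    and mov: "\<forall>h. mov h \<longrightarrow> \<not> mov (\<sigma> h)"
    and S: "shift \<sigma> mov F = S" and T: "shift \<sigma> mov G = T"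
    and cross: "\<And>h g. h \<in> F \<Longrightarrow> g \<in> G \<Longrightarrow> R h g"
    and adj: "\<And>h g. R (\<sigma> h) g \<longleftrightarrow> R h (\<sigma> g)"
    and av1: "\<And>h1 h2. h1 \<in> S \<Longrightarrow> \<sigma> h1 \<notin> S \<Longrightarrow> h2 \<in> S \<Longrightarrow> \<sigma> h2 \<notin> S \<Longrightarrow>
      \<exists>g\<in>T. \<sigma> g \<notin> T \<and> \<not> R h1 (\<sigma> g) \<and> \<not> R h2 (\<sigma> g)"
    and av2: "\<And>g. g \<in> T \<Longrightarrow> \<sigma> g \<notin> T \<Longrightarrow> \<exists>h\<in>S. \<sigma> h \<notin> S \<and> \<not> R h (\<sigma> g)"
  shows "F = S \<and> G = T \<or> F = \<sigma> ` S \<and> G = \<sigma> ` T"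
proof -
  note F = shift_eq_split[OF fin(1) inv mov S] and G = shift_eq_split[OF fin(2) inv mov T]
  show ?thesis
  proof (cases "\<forall>h\<in>S. \<sigma> h \<notin> S \<longrightarrow> h \<in> F")
    case True
    moreover have "g \<in> G" if "g \<in> T" "\<sigma> g \<notin> T" for g
      using av2[OF that] True G(1)[OF that(1)] cross by blast
    ultimately show ?thesis
      using F(2) G(2) by blast
  next
    case False
    then obtain h0 where h0: "h0 \<in> S" "\<sigma> h0 \<notin> S" "h0 \<notin> F"
      by blast
    have *: "h \<notin> F" if h: "h \<in> S" "\<sigma> h \<notin> S" for h
    proof
      assume "h \<in> F"
      obtain g where g: "g \<in> T" "\<not> R h (\<sigma> g)" "\<not> R h0 (\<sigma> g)"
        using av1[OF h h0(1,2)] by blast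
      have "\<sigma> h0 \<in> F"
        using F(1) h0 by blast
      then have "g \<notin> G"
        using cross adj g(3) by blast
      then show False
        using G(1)[OF g(1)] cross \<open>h \<in> F\<close> g(2) by blast
    qed
    have "\<sigma> g \<in> G" if g: "g \<in> T" "\<sigma> g \<notin> T" for g
    proof -
      obtain h where h: "h \<in> S" "\<sigma> h \<notin> S" "\<not> R h (\<sigma> g)"
        using av2[OF g] by blast
      then have "\<sigma> h \<in> F"
        using * F(1) by blast
      then show ?thesis
        using cross adj h(3) G(1)[OF g(1)] by blast
    qed
    then show ?thesis
      using * F(1,3) G(3) by blast
  qed
qed

section \<open>Signed sets as total functions\<close>

text \<open>
  A signed set \<open>(A, f)\<close> is encoded by the total function that agrees with \<open>f\<close> on \<open>A\<close> and is \<open>0\<close>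
  elsewhere, so \<open>A\<close> becomes the support and a permutation of positions or of values is a plain
  composition.
\<close>

definition sfuns :: "nat set \<Rightarrow> nat \<Rightarrow> nat \<Rightarrow> (nat \<Rightarrow> nat) set" where
  "sfuns D q m = {h. (\<forall>x. h x \<le> q) \<and> {x. h x \<noteq> 0} \<subseteq> D \<and> card {x. h x \<noteq> 0} = m}"

definition to_sfun :: "signed_set \<Rightarrow> nat \<Rightarrow> nat" where
  "to_sfun = (\<lambda>(A, f) x. if x \<in> A then f x else 0)"

lemma sfuns_le: "h \<in> sfuns D q m \<Longrightarrow> h x \<le> q"
  by (simp add: sfuns_def)

lemma sfuns_support: "h \<in> sfuns D q m \<Longrightarrow> h x \<noteq> 0 \<Longrightarrow> x \<in> D"
  by (auto simp: sfuns_def)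

lemma finite_support: "h \<in> sfuns D q m \<Longrightarrow> finite D \<Longrightarrow> finite {x. h x \<noteq> 0}"
  by (auto simp: sfuns_def intro: finite_subset)

lemma support_to_sfun: "f \<in> A \<rightarrow>\<^sub>E {1..q} \<Longrightarrow> {x. to_sfun (A, f) x \<noteq> 0} = A"
  by (fastforce simp: to_sfun_def PiE_iff)

lemma bij_betw_to_sfun:
  "bij_betw to_sfun {(A, f). A \<subseteq> D \<and> card A = m \<and> f \<in> A \<rightarrow>\<^sub>E {1..q}} (sfuns D q m)"
  unfolding bij_betw_def
proof (intro conjI inj_onI equalityI subsetI)
  fix u v
  assume "u \<in> {(A, f). A \<subseteq> D \<and> card A = m \<and> f \<in> A \<rightarrow>\<^sub>E {1..q}}"
    "v \<in> {(A, f). A \<subseteq> D \<and> card A = m \<and> f \<in> A \<rightarrow>\<^sub>E {1..q}}" and eq: "to_sfun u = to_sfun v"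
  then obtain A f B g where uv: "u = (A, f)" "v = (B, g)"
    and fg: "f \<in> A \<rightarrow>\<^sub>E {1..q}" "g \<in> B \<rightarrow>\<^sub>E {1..q}"
    by blast
  have "A = B"
    using support_to_sfun[OF fg(1)] support_to_sfun[OF fg(2)] eq uv by simp
  moreover have "f x = g x" if "x \<in> A" for x
    using fun_cong[OF eq, of x] that \<open>A = B\<close> by (simp add: to_sfun_def uv)
  ultimately show "u = v"
    using fg by (auto simp: uv intro: PiE_ext)
next
  fix h
  assume "h \<in> to_sfun ` {(A, f). A \<subseteq> D \<and> card A = m \<and> f \<in> A \<rightarrow>\<^sub>E {1..q}}"
  then obtain A f where h: "h = to_sfun (A, f)" "A \<subseteq> D" "card A = m" "f \<in> A \<rightarrow>\<^sub>E {1..q}"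
    by blast
  show "h \<in> sfuns D q m"
    using h support_to_sfun[OF h(4)] by (auto simp: sfuns_def) (auto simp: to_sfun_def PiE_iff)
next
  fix h
  assume h: "h \<in> sfuns D q m"
  let ?A = "{x. h x \<noteq> 0}"
  have "h = to_sfun (?A, restrict h ?A)"
    by (auto simp: to_sfun_def)
  moreover have "restrict h ?A \<in> ?A \<rightarrow>\<^sub>E {1..q}"
    using sfuns_le[OF h] by (auto simp: Suc_le_eq)
  ultimately show "h \<in> to_sfun ` {(A, f). A \<subseteq> D \<and> card A = m \<and> f \<in> A \<rightarrow>\<^sub>E {1..q}}"
    using h by (intro image_eqI[of _ _ "(?A, restrict h ?A)"]) (auto simp: sfuns_def)
qed

lemma card_sfuns:
  assumes "finite D"
  shows "finite (sfuns D q m)" "card (sfuns D q m) = (card D choose m) * q ^ m"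
proof -
  let ?S = "SIGMA A : {A. A \<subseteq> D \<and> card A = m}. A \<rightarrow>\<^sub>E {1..q}"
  have S: "{(A, f). A \<subseteq> D \<and> card A = m \<and> f \<in> A \<rightarrow>\<^sub>E {1..q}} = ?S"
    by auto
  have fin: "finite A" if "A \<subseteq> D" for A
    using that assms finite_subset by blast
  have "finite ?S"
    using assms fin by (intro finite_SigmaI) (auto intro: finite_PiE)
  then show "finite (sfuns D q m)"
    using bij_betw_finite[OF bij_betw_to_sfun[of D m q]] S by simp
  have "card ?S = (\<Sum>A | A \<subseteq> D \<and> card A = m. q ^ m)"
    using assms fin by (subst card_SigmaI) (auto intro!: sum.cong finite_PiE simp: card_PiE)
  also have "\<dots> = (card D choose m) * q ^ m"
    using n_subsets[OF assms] by simp
  finally show "card (sfuns D q m) = (card D choose m) * q ^ m"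
    using bij_betw_same_card[OF bij_betw_to_sfun[of D m q]] S by simp
qed

section \<open>Stars and agreement of total functions\<close>

definition star :: "nat \<Rightarrow> nat \<Rightarrow> nat \<Rightarrow> nat set \<Rightarrow> (nat \<Rightarrow> nat) \<Rightarrow> (nat \<Rightarrow> nat) set" where
  "star n q m X c = {h \<in> sfuns {1..n} q m. \<forall>x\<in>X. h x = c x}"

lemma star_subset: "star n q m X c \<subseteq> sfuns {1..n} q m"
  by (auto simp: star_def)

text \<open>Erasing the prescribed values and putting them back are inverse to each other; as these
  values are nonzero, the support shrinks by exactly \<open>s\<close>.\<close>

lemma star_bij:
  assumes X: "X \<subseteq> {1..n}" "card X = s" "s \<le> m" "c \<in> X \<rightarrow> {1..q}"
  shows "bij_betw (\<lambda>h x. if x \<in> X then 0 else h x) (star n q m X c) (sfuns ({1..n} - X) q (m - s))"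
proof (rule bij_betw_byWitness[where f' = "\<lambda>h x. if x \<in> X then c x else h x"])
  have fX: "finite X"
    using X finite_subset by blast
  have c0: "c x \<noteq> 0" "c x \<le> q" if "x \<in> X" for x
    using X(4) that by (auto simp: Pi_iff Suc_le_eq)
  show "\<forall>h\<in>star n q m X c. (\<lambda>x. if x \<in> X then c x else if x \<in> X then 0 else h x) = h"
    by (auto simp: star_def)
  show "\<forall>h\<in>sfuns ({1..n} - X) q (m - s).
      (\<lambda>x. if x \<in> X then 0 else if x \<in> X then c x else h x) = h"
    using sfuns_support by fastforce
  show "(\<lambda>h x. if x \<in> X then 0 else h x) ` star n q m X c \<subseteq> sfuns ({1..n} - X) q (m - s)"
  proof (intro image_subsetI)
    fix h assume h: "h \<in> star n q m X c"
    have "{x. (if x \<in> X then 0 else h x) \<noteq> 0} = {x. h x \<noteq> 0} - X"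
      by auto
    moreover have "X \<subseteq> {x. h x \<noteq> 0}"
      using h c0 by (auto simp: star_def)
    moreover have "card {x. h x \<noteq> 0} = m" "{x. h x \<noteq> 0} \<subseteq> {1..n}" "\<forall>x. h x \<le> q"
      using h by (auto simp: star_def sfuns_def)
    ultimately show "(\<lambda>x. if x \<in> X then 0 else h x) \<in> sfuns ({1..n} - X) q (m - s)"
      using X fX unfolding sfuns_def by (auto simp: card_Diff_subset)
  qed
  show "(\<lambda>h x. if x \<in> X then c x else h x) ` sfuns ({1..n} - X) q (m - s) \<subseteq> star n q m X c"
  proof (intro image_subsetI)
    fix h assume h: "h \<in> sfuns ({1..n} - X) q (m - s)"
    have *: "{x. (if x \<in> X then c x else h x) \<noteq> 0} = {x. h x \<noteq> 0} \<union> X"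
      using c0 by auto
    have "{x. h x \<noteq> 0} \<inter> X = {}"
      using sfuns_support[OF h] by blast
    then have "card ({x. h x \<noteq> 0} \<union> X) = m"
      using fX finite_support[OF h] X h by (subst card_Un_disjoint) (auto simp: sfuns_def)
    moreover have "{x. h x \<noteq> 0} \<union> X \<subseteq> {1..n}"
      using h X by (auto simp: sfuns_def)
    ultimately show "(\<lambda>x. if x \<in> X then c x else h x) \<in> star n q m X c"
      unfolding star_def sfuns_def mem_Collect_eq * using sfuns_le[OF h] c0 by auto
  qed
qed

lemma card_star:
  assumes "X \<subseteq> {1..n}" "card X = s" "s \<le> m" "c \<in> X \<rightarrow> {1..q}"
  shows "card (star n q m X c) = (n - s choose (m - s)) * q ^ (m - s)"
proof -
  have "card ({1..n} - X) = n - s"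
    using assms by (subst card_Diff_subset) (auto intro: finite_subset)
  then show ?thesis
    using bij_betw_same_card[OF star_bij[OF assms]] card_sfuns[of "{1..n} - X" q "m - s"] by simp
qed

text \<open>The value set \<open>V\<close> allows two notions of intersection: \<open>{0<..}\<close>
  is genuine agreement of signed sets, as 0 encodes absence, and \<open>{1}\<close> counts only
  common ones.\<close>

definition agree :: "nat set \<Rightarrow> (nat \<Rightarrow> nat) \<Rightarrow> (nat \<Rightarrow> nat) \<Rightarrow> nat set" where
  "agree V h g = {x. h x = g x \<and> h x \<in> V}"

lemma agree_commute: "agree V h g = agree V g h"
  by (auto simp: agree_def)

lemma finite_agree: "h \<in> sfuns {1..n} q m \<Longrightarrow> 0 \<notin> V \<Longrightarrow> finite (agree V h g)"
  by (rule finite_subset[OF _ finite_support[of h "{1..n}" q m]]) (auto simp: agree_def intro: gr0I)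

text \<open>\<open>g\<close> must avoid \<open>h1\<close> and \<open>h2\<close> outside \<open>X\<close>; a position is lost only if \<open>q = 2\<close> and
  \<open>h1\<close>, \<open>h2\<close> take both values there.\<close>

lemma exists_star_avoiding:
  assumes X: "X \<subseteq> Y" "Y \<subseteq> {1..n}" "card X = t" "card Y \<le> t + 1" "c \<in> X \<rightarrow> {1..q}"
    and m: "t \<le> m2" "m1 \<le> K" "m2 \<le> K" "K < n" and q: "q \<ge> 2" "q \<ge> 3 \<or> 2 * K + 1 \<le> n + t"
    and h: "h1 \<in> star n q m1 X c" "h2 \<in> star n q m1 X c"
  shows "\<exists>g\<in>star n q m2 X c. (\<forall>y\<in>Y - X. g y = 0) \<and>
    (\<forall>y. y \<notin> X \<longrightarrow> g y \<noteq> 0 \<longrightarrow> g y \<noteq> h1 y \<and> g y \<noteq> h2 y)"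
proof -
  define good where "good = {y \<in> {1..n} - Y. \<exists>w\<in>{1..q}. w \<noteq> h1 y \<and> w \<noteq> h2 y}"
  have fin: "finite Y" "finite X"
    using finite_subset[OF X(2)] finite_subset[OF X(1)] by simp_all
  have cY: "card ({1..n} - Y) \<ge> n - (t + 1)"
    using X(2,4) fin by (simp add: card_Diff_subset)
  have "m2 - t \<le> card good"
  proof (cases "q \<ge> 3")
    case True
    have "good = {1..n} - Y"
    proof -
      have "{1..q} - {a, b} \<noteq> {}" for a b :: nat
      proof
        assume "{1..q} - {a, b} = {}"
        then have "card {1..q} \<le> card {a, b}"
          by (intro card_mono) auto
        also have "\<dots> \<le> 2"
          by (simp add: card_insert_if)
        finally show False
          using True by simp
      qed
      then have "\<exists>w\<in>{1..q}. w \<noteq> a \<and> w \<noteq> b" for a b :: nat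
        by blast
      then show ?thesis
        unfolding good_def by blast
    qed
    then show ?thesis
      using cY m by simp
  next
    case False
    have two: "\<exists>w\<in>{1..q}. w \<noteq> 0 \<and> w \<noteq> b" for b :: nat
    proof (cases "b = 1")
      case True
      with q show ?thesis
        by (intro bexI[of _ 2]) auto
    next
      case False
      with q show ?thesis
        by (intro bexI[of _ 1]) auto
    qed
    have sub: "{1..n} - Y - ({x. h1 x \<noteq> 0} - X) \<subseteq> good"
    proof
      fix y assume y: "y \<in> {1..n} - Y - ({x. h1 x \<noteq> 0} - X)"
      then have "h1 y = 0"
        using X(1) by blast
      then show "y \<in> good"
        using y two[of "h2 y"] by (simp add: good_def)
    qed
    have h1: "h1 \<in> sfuns {1..n} q m1" "X \<subseteq> {x. h1 x \<noteq> 0}"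
      using h(1) X(5) by (auto simp: star_def Pi_iff Suc_le_eq)
    have fh: "finite {x. h1 x \<noteq> 0}"
      using finite_support[OF h1(1)] by simp
    have "card ({x. h1 x \<noteq> 0} - X) = m1 - t"
      using h1 X(3) fin(2) by (simp add: card_Diff_subset sfuns_def)
    \<comment> \<open>At least n - (t + 1) positions lie outside \<open>Y\<close>, and at most m1 -
      t of them are spoiled by \<open>h1\<close>. The rest has room for m2 - t values because m1 +
      m2 + 1 \<le> 2 K + 1 \<le> n + t.\<close>
    then have "n - (t + 1) - (m1 - t) \<le> card ({1..n} - Y - ({x. h1 x \<noteq> 0} - X))"
      using cY diff_card_le_card_Diff[OF finite_Diff[OF fh], of "{1..n} - Y" X]
      by linarith
    also have "\<dots> \<le> card good"
      by (rule card_mono[OF _ sub]) (simp add: good_def)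
    finally show ?thesis
      using m q(2) False by linarith
  qed
  then obtain D where D: "D \<subseteq> good" "card D = m2 - t" "finite D"
    by (rule obtain_subset_with_card_n)
  define g where "g y = (if y \<in> X then c y else if y \<in> D then
    (SOME w. w \<in> {1..q} \<and> w \<noteq> h1 y \<and> w \<noteq> h2 y) else 0)" for y
  have gD: "g y \<in> {1..q} \<and> g y \<noteq> h1 y \<and> g y \<noteq> h2 y" if "y \<in> D" "y \<notin> X" for y
  proof -
    have "\<exists>w. w \<in> {1..q} \<and> w \<noteq> h1 y \<and> w \<noteq> h2 y"
      using D(1) that unfolding good_def by blast
    from someI_ex[OF this] show ?thesis
      using that by (simp add: g_def)
  qed
  have gX: "g y = c y" "c y \<in> {1..q}" if "y \<in> X" for y
    using that X(5) by (auto simp: g_def)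
  have g0: "g y = 0" if "y \<notin> X" "y \<notin> D" for y
    using that by (simp add: g_def)
  have disj: "D \<inter> X = {}"
    using D X by (auto simp: good_def)
  have supp: "{x. g x \<noteq> 0} = X \<union> D"
  proof (intro set_eqI)
    show "y \<in> {x. g x \<noteq> 0} \<longleftrightarrow> y \<in> X \<union> D" for y
      using gD[of y] gX[of y] g0[of y] by (cases "y \<in> X"; cases "y \<in> D") auto
  qed
  have "card (X \<union> D) = m2"
    using fin D disj X m by (subst card_Un_disjoint) auto
  moreover have "X \<union> D \<subseteq> {1..n}"
    using X D by (auto simp: good_def)
  moreover have "g y \<le> q" for y
    using gD[of y] gX[of y] g0[of y] by (cases "y \<in> X"; cases "y \<in> D") auto
  ultimately have "g \<in> star n q m2 X c"
    unfolding star_def sfuns_def mem_Collect_eq supp using gX(1) by blast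
  moreover have "\<forall>y\<in>Y - X. g y = 0"
    using D(1) g0 unfolding good_def by blast
  moreover have "\<forall>y. y \<notin> X \<longrightarrow> g y \<noteq> 0 \<longrightarrow> g y \<noteq> h1 y \<and> g y \<noteq> h2 y"
  proof (intro allI impI)
    fix y assume "y \<notin> X" "g y \<noteq> 0"
    then show "g y \<noteq> h1 y \<and> g y \<noteq> h2 y"
      using gD[of y] g0[of y] by (cases "y \<in> D") auto
  qed
  ultimately show ?thesis
    by (intro bexI conjI)
qed

section \<open>Lattice walks of shifted families\<close>

definition shifted :: "nat set set \<Rightarrow> bool" where
  "shifted \<A> \<longleftrightarrow>
    (\<forall>A\<in>\<A>. \<forall>i j. 1 \<le> i \<longrightarrow> i < j \<longrightarrow> j \<in> A \<longrightarrow> i \<notin> A \<longrightarrow> insert i (A - {j}) \<in> \<A>)"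

lemma card_Int_Suc_le:
  "card (A \<inter> {1..Suc i}) \<le> Suc (card (A \<inter> {1..i}))"
proof -
  have "A \<inter> {1..Suc i} \<subseteq> insert (Suc i) (A \<inter> {1..i})"
    by auto
  then have "card (A \<inter> {1..Suc i}) \<le> card (insert (Suc i) (A \<inter> {1..i}))"
    by (rule card_mono[rotated]) simp
  then show ?thesis
    using card_insert_le_m1 by (simp add: card_insert_if split: if_splits)
qed

lemma card_Int_add_le:
  "card (A \<inter> {1..i + d}) \<le> card (A \<inter> {1..i}) + (d::nat)"
proof (induction d)
  case (Suc d)
  then show ?case
    using card_Int_Suc_le[of A "i + d"] by simp
qed simp

lemma card_Int_mono: "i \<le> j \<Longrightarrow> card (A \<inter> {1..i}) \<le> card (A \<inter> {1..(j::nat)})"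
  by (intro card_mono) auto

lemma card_Int_le: "card (A \<inter> {1..i}) \<le> (i::nat)"
  using card_mono[of "{1..i}" "A \<inter> {1..i}"] by simp

text \<open>
  Otherwise let \<open>j\<close> be the \<open>t\<close>-th common element. Some \<open>i < j\<close> lies in neither set, and replacing
  \<open>j\<close> by \<open>i\<close> in \<open>A\<close> gives a pair with the same property but a smaller intersection.
\<close>

lemma shifted_cross_walk:
  assumes sh: "shifted \<A>" and fin: "\<And>A. A \<in> \<A> \<Longrightarrow> finite A \<and> 0 \<notin> A" "finite B"
    and cross: "\<And>A. A \<in> \<A> \<Longrightarrow> t \<le> card (A \<inter> B)" and t: "t \<ge> 1"
    and "A \<in> \<A>"
  shows "\<exists>i. i + t \<le> card (A \<inter> {1..i}) + card (B \<inter> {1..i})"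
  using \<open>A \<in> \<A>\<close>
proof (induction "card (A \<inter> B)" arbitrary: A rule: less_induct)
  case less
  have UnInt: "card (A \<inter> {1..i}) + card (B \<inter> {1..i}) =
      card ((A \<union> B) \<inter> {1..i}) + card (A \<inter> B \<inter> {1..i})" for i
    using card_Un_Int[of "A \<inter> {1..i}" "B \<inter> {1..i}"]
    by (simp add: Int_Un_distrib2 Int_ac)
  show ?case
  proof (rule ccontr)
    assume "\<not> ?case"
    then have neg: "card (A \<inter> {1..i}) + card (B \<inter> {1..i}) < i + t" for i
      by (meson not_le)
    define j where "j = (LEAST j. t \<le> card (A \<inter> B \<inter> {1..j}))"
    have finA: "finite A" "0 \<notin> A"
      using fin(1)[OF less.prems] by auto
    obtain b where "\<forall>x\<in>A. x \<le> b"
      using finA(1) by (meson finite_nat_set_iff_bounded_le)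
    then have "A \<inter> B \<inter> {1..b} = A \<inter> B"
      using finA(2) by (auto simp: Suc_le_eq intro: gr0I)
    then have "t \<le> card (A \<inter> B \<inter> {1..b})"
      using cross[OF less.prems] by simp
    then have tj: "t \<le> card (A \<inter> B \<inter> {1..j})"
      unfolding j_def by (rule LeastI)
    have small: "card (A \<inter> B \<inter> {1..m}) < t" if "m < j" for m
      using not_less_Least that unfolding j_def by (meson not_le)
    obtain j' where j': "j = Suc j'"
      using tj t by (cases j) auto
    have jAB: "j \<in> A \<inter> B"
    proof (rule ccontr)
      assume "j \<notin> A \<inter> B"
      then have "A \<inter> B \<inter> {1..j} = A \<inter> B \<inter> {1..j'}"
        by (auto simp: j' le_Suc_eq)
      then show False
        using tj small[of j'] j' by simp
    qed
    have "card ((A \<union> B) \<inter> {1..j}) < card {1..j}"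
      using neg[of j] UnInt[of j] tj by simp
    then obtain i where i: "i \<in> {1..j}" "i \<notin> A \<union> B"
      by (metis Int_absorb1 less_irrefl subsetI)
    have ij: "i < j" "1 \<le> i"
      using i jAB by (cases "i = j"; auto)+
    define A' where "A' = insert i (A - {j})"
    have "A' \<in> \<A>"
      using sh ij i jAB less.prems unfolding shifted_def A'_def by blast
    moreover have "A' \<inter> B = A \<inter> B - {j}"
      using i by (auto simp: A'_def)
    then have "card (A' \<inter> B) < card (A \<inter> B)"
      using jAB finA(1) by (metis card_Diff1_less finite_Int)
    ultimately obtain m where m: "m + t \<le> card (A' \<inter> {1..m}) + card (B \<inter> {1..m})"
      using less.hyps by blast
    \<comment> \<open>Below \<open>i\<close> and from \<open>j\<close> on, \<open>A'\<close> has the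
      same counts as \<open>A\<close>. In between, the union misses \<open>i\<close> and fewer than
      \<open>t\<close> elements are common, so the counts of \<open>A\<close> and \<open>B\<close>
      sum to at most (m - 1) + (t - 1), and the one new element still does not reach m + t.\<close>
    consider "m < i" | "i \<le> m" "m < j" | "j \<le> m"
      by linarith
    then show False
    proof cases
      case 1
      then have "A' \<inter> {1..m} = A \<inter> {1..m}"
        using ij by (auto simp: A'_def)
      then show False
        using m neg[of m] by simp
    next
      case 2
      then have "A' \<inter> {1..m} = insert i (A \<inter> {1..m})"
        using ij by (auto simp: A'_def)
      then have "card (A' \<inter> {1..m}) = Suc (card (A \<inter> {1..m}))"
        using i by simp
      moreover have "(A \<union> B) \<inter> {1..m} \<subset> {1..m}"
        using i 2(1) by (metis IntE Int_lower2 psubsetI atLeastAtMost_iff)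
      then have "card ((A \<union> B) \<inter> {1..m}) < card {1..m}"
        by (rule psubset_card_mono[rotated]) simp
      ultimately show False
        using m UnInt[of m] small[OF 2(2)] by simp
    next
      case 3
      then have "A' \<inter> {1..m} = insert i (A \<inter> {1..m} - {j})"
        using ij by (auto simp: A'_def)
      then have "card (A' \<inter> {1..m}) = Suc (card (A \<inter> {1..m} - {j}))"
        using i by simp
      also have "\<dots> = card (A \<inter> {1..m})"
        using jAB 3 ij by (intro card.remove[symmetric]) auto
      finally show False
        using m neg[of m] by simp
    qed
  qed
qed

text \<open>\<open>hits v A\<close>: the lattice walk of \<open>A\<close>, with a step up at each element and a step right at each
  non-element, meets the line \<open>y = x + v\<close>.\<close>

definition hits :: "nat \<Rightarrow> nat set \<Rightarrow> bool" where
  "hits v A \<longleftrightarrow> (\<exists>j. v + j \<le> card (A \<inter> {1..v + 2 * j}))"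

lemma hits_le_card: "hits v A \<Longrightarrow> finite A \<Longrightarrow> v \<le> card A"
  unfolding hits_def by (meson Int_lower1 add_leD1 card_mono le_trans)

text \<open>\<open>B\<close> stays below the line y = x + v + 1, so it has at most v + j of the
  first v + 2 j + 1 positions, and the walk inequality forces the remaining elements on
  \<open>A\<close>. The bound v + j \<le> M keeps the prefix lengths v + 2 j at most 2 M, as the
  counting requires.\<close>

lemma walk_avoiding_line:
  assumes walk: "i + t \<le> card (A \<inter> {1..i}) + card (B \<inter> {1..i})"
    and B: "\<not> hits (Suc v) B" "t \<le> v" "v \<le> M" "card B \<le> M" "finite B"
  shows "\<exists>j. v + j \<le> M \<and> t + j \<le> card (A \<inter> {1..v + 2 * j})"
proof -
  define a where "a i = card (A \<inter> {1..i})" for i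
  define b where "b i = card (B \<inter> {1..i})" for i
  have line: "b (Suc v + 2 * j) \<le> v + j" for j
    using B(1) unfolding hits_def b_def by (metis add_Suc not_less_eq_eq)
  have bM: "b i \<le> M" for i
    using B(4,5) unfolding b_def by (meson Int_lower1 card_mono le_trans)
  have walk': "i + t \<le> a i + b i"
    using walk by (simp add: a_def b_def)
  have a_add: "a (i + d) \<le> a i + d" for i d
    using card_Int_add_le by (simp add: a_def)
  have b_add: "b (i + d) \<le> b i + d" for i d
    using card_Int_add_le by (simp add: b_def)
  show ?thesis
  proof (cases "i \<le> v")
    case True
    have "b i \<le> i" "a i \<le> a v"
      using True by (simp_all add: a_def b_def card_Int_le card_Int_mono del: One_nat_def)
    then have "t \<le> a v"
      using walk' by linarith
    then show ?thesis
      using B(3) by (intro exI[of _ 0]) (simp add: a_def)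
  next
    case False
    define j where "j = (i - v) div 2"
    have j: "t + j \<le> a (v + 2 * j)"
    \<comment> \<open>The missed line controls \<open>b\<close> at lengths v + 1 + 2 j only. For
      even i - v one further step of \<open>b\<close> is allowed for; for odd i - v one step of
      \<open>a\<close> is given back.\<close>
    proof (cases "even (i - v)")
      case True
      then have i: "i = v + 2 * j"
        using False by (auto simp: j_def)
      then obtain j' where "j = Suc j'"
        using False by (cases j) auto
      then have "b i \<le> v + j"
        using line[of j'] b_add[of "Suc v + 2 * j'" 1] i by simp
      then show ?thesis
        using walk' i by simp
    next
      case odd: False
      then have i: "i = Suc v + 2 * j"
        using odd_two_times_div_two_succ[OF odd] False unfolding j_def by linarith
      then show ?thesis
        using walk' line[of j] a_add[of "v + 2 * j" 1] by simp
    qed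
    show ?thesis
    proof (cases "v + j \<le> M")
      case True
      then show ?thesis
        using j by (auto simp: a_def)
    next
      \<comment> \<open>At such lengths card B \<le> M is stronger than the missed line:
        \<open>A\<close> has at least i + t - M elements up to \<open>i\<close>, and cutting off the
        last \<open>d\<close> positions loses at most \<open>d\<close> of them. With c = M - v this
        leaves t + c.\<close>
      case big: False
      define c where "c = M - v"
      have "v + 2 * c \<le> i"
        using big False B(3) by (simp add: c_def j_def)
      then obtain d where d: "i = v + 2 * c + d"
        using le_Suc_ex by blast
      have "t + c \<le> a (v + 2 * c)"
        using walk' bM[of i] a_add[of "v + 2 * c" d] B(3) unfolding d c_def by linarith
      then show ?thesis
        using B(3) by (intro exI[of _ c]) (simp add: a_def c_def)
    qed
  qed
qed

text \<open>At length t + 2 j, with this length equal to i or i - 1, \<open>B\<close> has fewer than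
  t + j elements, so \<open>A\<close> must have at least t + j; stepping back from i to i - 1 costs
  at most one element of each set. Hence one of the two families meets the line y = x + t with all
  its walks.\<close>

lemma walk_hits:
  assumes walk: "i + t \<le> card (A \<inter> {1..i}) + card (B \<inter> {1..i})"
    and B: "\<not> hits t B"
  shows "hits t A"
proof -
  define a where "a i = card (A \<inter> {1..i})" for i
  define b where "b i = card (B \<inter> {1..i})" for i
  have line: "b (t + 2 * j) < t + j" for j
    using B unfolding hits_def b_def by (meson not_le)
  have walk': "i + t \<le> a i + b i"
    using walk by (simp add: a_def b_def)
  have ai: "a i \<le> i" "b i \<le> i"
    by (simp_all add: a_def b_def card_Int_le del: One_nat_def)
  have a_add: "a (i + d) \<le> a i + d" for i d
    using card_Int_add_le by (simp add: a_def)
  have b_add: "b (i + d) \<le> b i + d" for i d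
    using card_Int_add_le by (simp add: b_def)
  have ti: "t \<le> i"
    using walk' ai by linarith
  define j where "j = (i - t) div 2"
  have "t + j \<le> a (t + 2 * j)"
  proof (cases "even (i - t)")
    case True
    then have "i = t + 2 * j"
      using ti by (auto simp: j_def)
    then show ?thesis
      using walk' line[of j] by simp
  next
    case False
    then have "i = t + 2 * j + 1"
      using odd_two_times_div_two_succ[OF False] ti unfolding j_def by linarith
    then show ?thesis
      using walk' line[of j] a_add[of "t + 2 * j" 1] b_add[of "t + 2 * j" 1] by simp
  qed
  then show ?thesis
    unfolding hits_def a_def by blast
qed

lemma exists_max_line:
  assumes "\<B> \<noteq> {}" "\<And>B. B \<in> \<B> \<Longrightarrow> finite B" "\<And>B. B \<in> \<B> \<Longrightarrow> hits t B"
  shows "\<exists>v\<ge>t. (\<forall>B\<in>\<B>. hits v B) \<and> (\<exists>B\<in>\<B>. \<not> hits (Suc v) B)"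
proof -
  obtain B0 where B0: "B0 \<in> \<B>"
    using assms(1) by blast
  define P where "P v \<longleftrightarrow> t \<le> v \<and> (\<forall>B\<in>\<B>. hits v B)" for v
  have "P t"
    using assms by (simp add: P_def)
  moreover have bd: "P v \<Longrightarrow> v \<le> card B0" for v
    using B0 assms(2) hits_le_card by (auto simp: P_def)
  ultimately have "P (GREATEST v. P v)"
    by (rule GreatestI_nat)
  moreover have "\<not> P (Suc (GREATEST v. P v))"
    using Greatest_le_nat[of P _ "card B0"] bd by (meson not_less_eq_eq order_refl)
  ultimately show ?thesis
    unfolding P_def by (meson le_SucI)
qed

section \<open>Counting functions with many ones\<close>

definition ones :: "(nat \<Rightarrow> nat) \<Rightarrow> nat set" where
  "ones h = {x. h x = 1}"

lemma ones_subset: "h \<in> sfuns {1..n} q m \<Longrightarrow> ones h \<subseteq> {1..n}"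
  using sfuns_support by (fastforce simp: ones_def)

lemma card_ones_le: "h \<in> sfuns {1..n} q m \<Longrightarrow> card (ones h) \<le> m"
proof -
  assume h: "h \<in> sfuns {1..n} q m"
  have "card (ones h) \<le> card {x. h x \<noteq> 0}"
    using finite_support[OF h] by (intro card_mono) (auto simp: ones_def)
  then show ?thesis
    using h by (simp add: sfuns_def)
qed

text \<open>The sum is a part of the exponential series at exp (-1). Without the index 0 the leading
  term 1 can be taken off, and this is the saving for members outside the star on
  \<open>{1..t}\<close>.\<close>

lemma sum_exp_le:
  assumes "finite J"
  shows "(\<Sum>j\<in>J. exp (-1) ^ (d + j) / fact (d + j)) \<le> exp (exp (-1) :: real)"
    and "(\<And>j. j \<in> J \<Longrightarrow> d + j \<noteq> 0) \<Longrightarrow>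
      (\<Sum>j\<in>J. exp (-1) ^ (d + j) / fact (d + j)) \<le> exp (exp (-1) :: real) - 1"
proof -
  let ?x = "exp (-1) :: real" and ?S = "(+) d ` J"
  have sums: "(\<lambda>s. ?x ^ s / fact s) sums exp ?x"
    using exp_converges[of ?x] by (simp add: divide_inverse mult.commute)
  have part: "(\<Sum>s\<in>S. ?x ^ s / fact s) \<le> exp ?x" if "finite S" for S
    using sum_le_suminf[of "\<lambda>s. ?x ^ s / fact s" S] sums that by (auto simp: sums_iff)
  have J: "(\<Sum>j\<in>J. ?x ^ (d + j) / fact (d + j)) = (\<Sum>s\<in>?S. ?x ^ s / fact s)"
    by (subst sum.reindex) auto
  show "(\<Sum>j\<in>J. ?x ^ (d + j) / fact (d + j)) \<le> exp ?x"
    unfolding J using assms by (intro part) simp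
  show "(\<Sum>j\<in>J. ?x ^ (d + j) / fact (d + j)) \<le> exp ?x - 1" if "\<And>j. j \<in> J \<Longrightarrow> d + j \<noteq> 0"
  proof -
    have "0 \<notin> ?S"
      using that by force
    then have "(\<Sum>s\<in>insert 0 ?S. ?x ^ s / fact s) = 1 + (\<Sum>s\<in>?S. ?x ^ s / fact s)"
      using assms by simp
    then show ?thesis
      unfolding J using part[of "insert 0 ?S"] assms by simp
  qed
qed

lemma exp_minus_one_le: "exp (-1) \<le> (2 / 5 :: real)"
proof -
  have "exp (1::real) \<ge> 5 / 2"
    using exp_lower_Taylor_quadratic[of 1] by simp
  then show ?thesis
    by (simp add: exp_minus field_simps)
qed

lemma exp_exp_minus_one_le: "exp (exp (-1)) \<le> (39 / 25 :: real)"
proof -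
  have "exp (exp (-1)) \<le> exp (2 / 5 :: real)"
    using exp_minus_one_le by simp
  also have "\<dots> \<le> 1 + 2 / 5 + (2 / 5)\<^sup>2"
    by (rule exp_bound) auto
  finally show ?thesis
    by (simp add: power2_eq_square)
qed

text \<open>The case distinction is needed since truncated subtraction would give the value 1 for
  \<open>s > m\<close>.\<close>

definition star_size :: "nat \<Rightarrow> nat \<Rightarrow> nat \<Rightarrow> nat \<Rightarrow> real" where
  "star_size n q m s = (if s \<le> m then real ((n - s choose (m - s)) * q ^ (m - s)) else 0)"

lemma star_size_nonneg: "0 \<le> star_size n q m s"
  by (simp add: star_size_def)

lemma card_ones_superset:
  assumes "card T = s" "finite T" "q \<ge> 1"
  shows "real (card {h \<in> sfuns {1..n} q m. T \<subseteq> ones h}) \<le> star_size n q m s"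
proof (cases "s \<le> m \<and> T \<subseteq> {1..n}")
  case True
  have "{h \<in> sfuns {1..n} q m. T \<subseteq> ones h} = star n q m T (\<lambda>_. 1)"
    by (auto simp: star_def ones_def)
  then show ?thesis
    using card_star[of T n s m "\<lambda>_. 1" q] True assms by (simp add: star_size_def)
next
  case False
  have "{h \<in> sfuns {1..n} q m. T \<subseteq> ones h} = {}"
  proof (rule equals0I)
    fix h assume "h \<in> {h \<in> sfuns {1..n} q m. T \<subseteq> ones h}"
    then have h: "h \<in> sfuns {1..n} q m" "T \<subseteq> ones h"
      by auto
    have "T \<subseteq> {1..n}"
      using ones_subset[OF h(1)] h(2) by blast
    moreover have "card T \<le> card (ones h)"
      using h ones_subset[OF h(1)] by (intro card_mono) (auto intro: finite_subset)
    ultimately show False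
      using False card_ones_le[OF h(1)] assms by simp
  qed
  then show ?thesis
    by (simp only: card.empty of_nat_0 star_size_nonneg)
qed

text \<open>Union bound over the \<open>s\<close>-subsets of \<open>{1..p}\<close>: each of them,
  with all values 1, is the centre of one star.\<close>

lemma card_many_ones:
  assumes "q \<ge> 1"
  shows "real (card {h \<in> sfuns {1..n} q m. s \<le> card (ones h \<inter> {1..p})}) \<le>
    real (p choose s) * star_size n q m s"
proof -
  let ?T = "{T. T \<subseteq> {1..p} \<and> card T = s}"
  let ?H = "\<lambda>T. {h \<in> sfuns {1..n} q m. T \<subseteq> ones h}"
  have fin: "finite ?T"
    by simp
  have finH: "finite (?H T)" for T
    by (simp add: card_sfuns)
  have "{h \<in> sfuns {1..n} q m. s \<le> card (ones h \<inter> {1..p})} \<subseteq> (\<Union>T\<in>?T. ?H T)"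
  proof
    fix h assume h: "h \<in> {h \<in> sfuns {1..n} q m. s \<le> card (ones h \<inter> {1..p})}"
    then obtain T where "T \<subseteq> ones h \<inter> {1..p}" "card T = s"
      using obtain_subset_with_card_n by blast
    then show "h \<in> (\<Union>T\<in>?T. ?H T)"
      using h by auto
  qed
  then have "card {h \<in> sfuns {1..n} q m. s \<le> card (ones h \<inter> {1..p})} \<le> card (\<Union>T\<in>?T. ?H T)"
    using fin finH by (intro card_mono) auto
  also have "\<dots> \<le> (\<Sum>T\<in>?T. card (?H T))"
    using fin by (rule card_UN_le)
  finally have "real (card {h \<in> sfuns {1..n} q m. s \<le> card (ones h \<inter> {1..p})}) \<le>
      (\<Sum>T\<in>?T. real (card (?H T)))"
    unfolding of_nat_sum[symmetric] of_nat_le_iff .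
  also have "\<dots> \<le> (\<Sum>T\<in>?T. star_size n q m s)"
    using assms by (intro sum_mono card_ones_superset) (auto intro: finite_subset)
  also have "\<dots> = real (p choose s) * star_size n q m s"
    using n_subsets[of "{1..p}" s] by simp
  finally show ?thesis .
qed

section \<open>Loss of size per prescribed element\<close>

locale signed_range =
  fixes n q t K :: nat
  assumes t_pos: "1 \<le> t" and t_le: "t \<le> K" and K_less: "K < n" and q_ge: "2 \<le> q"
    and bound: "2 * exp 1 * (real K - real t) * real K \<le> (real n - real t) * real q"
begin

definition \<rho> :: real where
  "\<rho> = exp (-1) / (2 * real K)"

abbreviation \<epsilon> :: real where
  "\<epsilon> \<equiv> exp (-1)"

lemma \<rho>: "0 < \<rho>" "\<rho> * (2 * real K) = \<epsilon>"
  using t_pos t_le by (auto simp: \<rho>_def)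

text \<open>Consecutive sizes have the ratio (m - s) / ((n - s) q). This is at most (K - t) / ((n -
  t) q), since (K - s) / (n - s) does not increase with s when K < n, and \<open>bound\<close> turns
  that into \<open>\<rho>\<close>.\<close>

lemma star_size_Suc:
  assumes "t \<le> s" "m \<le> K"
  shows "star_size n q m (Suc s) \<le> star_size n q m s * \<rho>"
proof (cases "Suc s \<le> m")
  case False
  then show ?thesis
    using \<rho> star_size_nonneg[of n q m s] by (simp add: star_size_def)
next
  case True
  define N where "N = real (n - Suc s choose (m - Suc s)) * real q ^ (m - Suc s)"
  have N: "star_size n q m (Suc s) = N"
    using True by (simp add: star_size_def N_def)
  have ms: "m - s = Suc (m - Suc s)" "n - s - 1 = n - Suc s"
    using True by auto
  have "(m - s) * (n - s choose (m - s)) = (n - s) * (n - Suc s choose (m - Suc s))"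
    using binomial_absorption[of "m - Suc s" "n - s"] unfolding ms(1) ms(2) .
  then have "real (m - s) * real (n - s choose (m - s)) =
      real (n - s) * real (n - Suc s choose (m - Suc s))"
    by (metis of_nat_mult)
  then have eq: "real (m - s) * star_size n q m s = real (n - s) * real q * N"
    using True unfolding star_size_def N_def by (simp add: ms(1) del: of_nat_Suc)
  have pos: "0 < real (n - s)" "0 < real (m - s)" "0 < real n - real t" "0 \<le> N"
    using True assms K_less t_le by (auto simp: N_def)
  have r: "real (m - s) = real m - real s" "real (n - s) = real n - real s"
    using True assms K_less by auto
  have "(real m - real s) * (real n - real t) \<le> (real K - real s) * (real n - real t)"
    using pos assms by (intro mult_right_mono) auto
  also have "\<dots> \<le> (real K - real t) * (real n - real s)"
  proof -
    have "(real s - real t) * (real n - real K) \<ge> 0"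
      using assms K_less by (intro mult_nonneg_nonneg) auto
    then show ?thesis
      by (simp add: algebra_simps)
  qed
  finally have "real (m - s) * (real n - real t) \<le> (real K - real t) * real (n - s)"
    by (simp add: r)
  then have "real (m - s) * (real n - real t) * (2 * exp 1 * real K) \<le>
      (real K - real t) * real (n - s) * (2 * exp 1 * real K)"
    by (rule mult_right_mono) simp
  also have "\<dots> = (2 * exp 1 * (real K - real t) * real K) * real (n - s)"
    by simp
  also have "\<dots> \<le> (real n - real t) * real q * real (n - s)"
    using bound by (intro mult_right_mono) auto
  finally have "(real n - real t) * (real (m - s) * (2 * exp 1 * real K)) \<le>
      (real n - real t) * (real q * real (n - s))"
    by (simp only: mult_ac)
  then have *: "real (m - s) * (2 * exp 1 * real K) \<le> real q * real (n - s)"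
    using pos(3) by (simp only: mult_le_cancel_left_pos)
  have inv: "\<rho> * (2 * exp 1 * real K) = 1"
  proof -
    have "\<rho> * (2 * exp 1 * real K) = \<rho> * (2 * real K) * exp 1"
      by (simp only: mult_ac)
    then show ?thesis
      unfolding \<rho>(2) by (simp flip: exp_add)
  qed
  have "real (m - s) * N = real (m - s) * (2 * exp 1 * real K) * N * \<rho>"
    using inv by (simp add: mult_ac)
  also have "\<dots> \<le> real q * real (n - s) * N * \<rho>"
    using * pos \<rho> by (intro mult_right_mono) auto
  also have "\<dots> = real (m - s) * (star_size n q m s * \<rho>)"
    using eq by (simp add: mult_ac)
  finally show ?thesis
    using pos(2) by (simp only: N mult_le_cancel_left_pos)
qed

lemma star_size_add:
  assumes "m \<le> K"
  shows "star_size n q m (t + d) \<le> star_size n q m t * \<rho> ^ d"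
proof (induction d)
  case (Suc d)
  have "star_size n q m (t + Suc d) \<le> star_size n q m (t + d) * \<rho>"
    using star_size_Suc[of "t + d" m] assms by simp
  also have "\<dots> \<le> star_size n q m t * \<rho> ^ d * \<rho>"
    using Suc \<rho> by (intro mult_right_mono) auto
  finally show ?case
    by (simp add: mult_ac)
qed simp

lemma star_size_pos: "t \<le> m \<Longrightarrow> m \<le> K \<Longrightarrow> 0 < star_size n q m t"
  using K_less q_ge by (simp add: star_size_def)

lemma binomial_rho_le:
  assumes "p \<le> 2 * K"
  shows "real (p choose s) * \<rho> ^ s \<le> \<epsilon> ^ s / fact s"
proof -
  have "real (p choose s) * fact s \<le> real p ^ s"
    using of_nat_mono[OF binomial_fact_pow[of p s], where 'a = real] by simp
  also have "\<dots> \<le> (2 * real K) ^ s"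
    using assms by (intro power_mono) auto
  finally have "real (p choose s) * fact s * \<rho> ^ s \<le> (2 * real K) ^ s * \<rho> ^ s"
    using \<rho> by (intro mult_right_mono) auto
  also have "\<dots> = \<epsilon> ^ s"
    by (simp add: \<rho>(2)[symmetric] power_mult_distrib mult_ac)
  finally show ?thesis
    by (simp add: field_simps)
qed

text \<open>By symmetry the binomial coefficient has lower index a - b + j and needs the power
  \<open>\<rho> ^ (a - b + j)\<close>, whereas prescribing t + b + j ones supplies
  \<open>\<rho> ^ (b + j)\<close>. The factor on the left balances the two and leaves
  \<open>\<rho> ^ b\<close>. With b = 0 the count of one family loses \<open>\<rho> ^ a\<close>;
  with b = a the other family gains it.\<close>

lemma card_hitting_le:
  assumes F: "F \<subseteq> sfuns {1..n} q m" "m \<le> K"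
    and J: "finite J" "\<And>j. j \<in> J \<Longrightarrow> t + a + 2 * j \<le> 2 * K"
    and hit: "\<And>h. h \<in> F \<Longrightarrow> \<exists>j\<in>J. t + b + j \<le> card (ones h \<inter> {1..t + a + 2 * j})"
    and ab: "b \<le> a"
  shows "real (card F) * \<rho> ^ (a - b) \<le>
    star_size n q m t * \<rho> ^ b * (\<Sum>j\<in>J. \<epsilon> ^ (a - b + j) / fact (a - b + j))"
proof -
  let ?H = "\<lambda>j. {h \<in> sfuns {1..n} q m. t + b + j \<le> card (ones h \<inter> {1..t + a + 2 * j})}"
  have "card F \<le> card (\<Union>j\<in>J. ?H j)"
    using F hit J(1) by (intro card_mono) (auto simp: card_sfuns)
  also have "\<dots> \<le> (\<Sum>j\<in>J. card (?H j))"
    using J(1) by (rule card_UN_le)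
  finally have "real (card F) \<le> (\<Sum>j\<in>J. real (card (?H j)))"
    unfolding of_nat_sum[symmetric] of_nat_le_iff .
  also have "\<dots> \<le> (\<Sum>j\<in>J. real (t + a + 2 * j choose (t + b + j)) * star_size n q m (t + b + j))"
    using q_ge by (intro sum_mono card_many_ones) auto
  finally have "real (card F) * \<rho> ^ (a - b) \<le>
      (\<Sum>j\<in>J. real (t + a + 2 * j choose (t + b + j)) * star_size n q m (t + b + j)) * \<rho> ^ (a - b)"
    using \<rho> by (intro mult_right_mono) auto
  also have "\<dots> \<le>
      (\<Sum>j\<in>J. star_size n q m t * \<rho> ^ b * (\<epsilon> ^ (a - b + j) / fact (a - b + j)))"
    unfolding sum_distrib_right
  proof (rule sum_mono)
    fix j assume j: "j \<in> J"
    define C where "C = real (t + a + 2 * j choose (t + b + j))"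
    have "t + a + 2 * j - (t + b + j) = a - b + j"
      using ab by simp
    then have C: "C = real (t + a + 2 * j choose (a - b + j))"
      using binomial_symmetric[of "t + b + j" "t + a + 2 * j"] ab by (simp add: C_def)
    have "C * star_size n q m (t + b + j) * \<rho> ^ (a - b) \<le>
        C * (star_size n q m t * \<rho> ^ (b + j)) * \<rho> ^ (a - b)"
      using star_size_add[OF F(2), of "b + j"] \<rho>
      by (intro mult_right_mono mult_left_mono) (auto simp: C_def add.assoc)
    also have "\<dots> = star_size n q m t * \<rho> ^ b * (C * \<rho> ^ (a - b + j))"
      by (simp add: power_add mult_ac)
    also have "\<dots> \<le> star_size n q m t * \<rho> ^ b * (\<epsilon> ^ (a - b + j) / fact (a - b + j))"
      unfolding C using J(2)[OF j] \<rho> star_size_nonneg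
      by (intro mult_left_mono binomial_rho_le) auto
    finally show "real (t + a + 2 * j choose (t + b + j)) * star_size n q m (t + b + j) * \<rho> ^ (a - b)
        \<le> star_size n q m t * \<rho> ^ b * (\<epsilon> ^ (a - b + j) / fact (a - b + j))"
      by (simp add: C_def)
  qed
  finally show ?thesis
    by (simp add: sum_distrib_left)
qed

text \<open>As \<open>g\<close> misses some x \<le> t, it has at most i - 1 elements up to i, so
  \<open>h\<close> has more than t there; if i > K + 1, then card (ones g) \<le> K still leaves t +
  1 ones of \<open>h\<close> up to K + 1. Thus \<open>h\<close> has a further one among at most K
  positions, which costs K \<open>\<rho>\<close> = \<open>\<epsilon> / 2\<close>.\<close>

lemma card_star_part_le:
  assumes F: "F \<subseteq> sfuns {1..n} q m" "m \<le> K" and g: "finite (ones g)" "card (ones g) \<le> K"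
    and walk: "\<And>h. h \<in> F \<Longrightarrow> \<exists>i. i + t \<le> card (ones h \<inter> {1..i}) + card (ones g \<inter> {1..i})"
    and not: "\<not> {1..t} \<subseteq> ones g"
  shows "real (card {h \<in> F. {1..t} \<subseteq> ones h}) \<le> star_size n q m t * (\<epsilon> / 2)"
proof -
  let ?H = "\<lambda>y. {h \<in> sfuns {1..n} q m. insert y {1..t} \<subseteq> ones h}"
  obtain x where x: "x \<in> {1..t}" "x \<notin> ones g"
    using not by blast
  have "\<exists>y\<in>{Suc t..Suc K}. h \<in> ?H y" if h: "h \<in> F" "{1..t} \<subseteq> ones h" for h
  proof -
    obtain i where i: "i + t \<le> card (ones h \<inter> {1..i}) + card (ones g \<inter> {1..i})"
      using walk[OF h(1)] by blast
    have "card (ones h \<inter> {1..i}) \<le> card (ones h \<inter> {1..Suc K + (i - Suc K)})"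
      by (rule card_Int_mono) simp
    also have "\<dots> \<le> card (ones h \<inter> {1..Suc K}) + (i - Suc K)"
      by (rule card_Int_add_le)
    finally have hi: "card (ones h \<inter> {1..i}) \<le> card (ones h \<inter> {1..Suc K}) + (i - Suc K)" .
    have hi': "card (ones h \<inter> {1..i}) \<le> i"
      by (rule card_Int_le)
    have gi: "card (ones g \<inter> {1..i}) \<le> K"
      using g by (meson Int_lower1 card_mono le_trans)
    have "t < card (ones h \<inter> {1..Suc K})"
    proof (cases "i < t")
      case True
      then show ?thesis
        using i hi' card_Int_le[of "ones g" i] by linarith
    next
      case False
      then have "ones g \<inter> {1..i} \<subseteq> {1..i} - {x}"
        using x by auto
      then have "card (ones g \<inter> {1..i}) \<le> i - 1"
        using card_mono[of "{1..i} - {x}" "ones g \<inter> {1..i}"] x False by simp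
      then show ?thesis
        using i hi hi' gi t_pos False card_Int_mono[of i "Suc K" "ones h"] by linarith
    qed
    then have "\<not> ones h \<inter> {1..Suc K} \<subseteq> {1..t}"
      using card_mono[of "{1..t}" "ones h \<inter> {1..Suc K}"] by auto
    then obtain y where "y \<in> ones h" "y \<in> {1..Suc K}" "y \<notin> {1..t}"
      by blast
    then show ?thesis
      using h F(1) by (intro bexI[of _ y]) auto
  qed
  then have "card {h \<in> F. {1..t} \<subseteq> ones h} \<le> card (\<Union>y\<in>{Suc t..Suc K}. ?H y)"
    by (intro card_mono) (auto simp: card_sfuns)
  also have "\<dots> \<le> (\<Sum>y\<in>{Suc t..Suc K}. card (?H y))"
    by (rule card_UN_le) simp
  finally have "real (card {h \<in> F. {1..t} \<subseteq> ones h}) \<le> (\<Sum>y\<in>{Suc t..Suc K}. real (card (?H y)))"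
    unfolding of_nat_sum[symmetric] of_nat_le_iff .
  also have "\<dots> \<le> (\<Sum>y\<in>{Suc t..Suc K}. star_size n q m (Suc t))"
    using q_ge by (intro sum_mono card_ones_superset) auto
  also have "\<dots> = real (Suc K - t) * star_size n q m (Suc t)"
    by simp
  also have "\<dots> \<le> real K * (star_size n q m t * \<rho>)"
    using star_size_Suc[of t m] F(2) t_pos star_size_nonneg by (intro mult_mono) auto
  also have "\<dots> = star_size n q m t * (\<epsilon> / 2)"
    unfolding \<rho>(2)[symmetric] by simp
  finally show ?thesis .
qed

end

section \<open>The bound for walks\<close>

context signed_range
begin

definition walks :: "(nat \<Rightarrow> nat) set \<Rightarrow> (nat \<Rightarrow> nat) set \<Rightarrow> bool" where
  "walks F G \<longleftrightarrow>
    (\<forall>h\<in>F. \<forall>g\<in>G. \<exists>i. i + t \<le> card (ones h \<inter> {1..i}) + card (ones g \<inter> {1..i}))"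

lemma walks_sym: "walks F G \<Longrightarrow> walks G F"
  by (fastforce simp: walks_def add.commute)

lemma finite_ones: "h \<in> sfuns {1..n} q m \<Longrightarrow> finite (ones h)"
  by (rule finite_subset[OF ones_subset]) auto

lemma card_line_diagonal_le:
  assumes F: "F \<subseteq> sfuns {1..n} q m" "m \<le> K"
    and J: "finite J" "\<And>j. j \<in> J \<Longrightarrow> t + 2 * j \<le> 2 * K"
    and hit: "\<And>h. h \<in> F \<Longrightarrow> \<exists>j\<in>J. t + j \<le> card (ones h \<inter> {1..t + 2 * j})"
  shows "real (card F) \<le> star_size n q m t * exp \<epsilon>"
    and "0 \<notin> J \<Longrightarrow> real (card F) \<le> star_size n q m t * (exp \<epsilon> - 1)"
proof -
  have *: "real (card F) \<le> star_size n q m t * (\<Sum>j\<in>J. \<epsilon> ^ (0 + j) / fact (0 + j))"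
    using card_hitting_le[of F m J 0 0] assms by simp
  show "real (card F) \<le> star_size n q m t * exp \<epsilon>"
    using * sum_exp_le(1)[OF J(1), of 0] star_size_nonneg mult_left_mono order_trans by blast
  show "real (card F) \<le> star_size n q m t * (exp \<epsilon> - 1)" if "0 \<notin> J"
    using * sum_exp_le(2)[OF J(1), of 0] that star_size_nonneg mult_left_mono order_trans
    by (metis add_0)
qed

text \<open>The index j = 0 can occur only for members containing \<open>{1..t}\<close>. All others
  are counted with j \<ge> 1, which removes the leading 1 of the series, and the members in the star
  are cut down by a single \<open>g\<close> outside it.\<close>

lemma card_diagonal_le:
  assumes F: "F \<subseteq> sfuns {1..n} q m" "m \<le> K"
    and hit: "\<forall>h\<in>F. \<exists>j. t + j \<le> M \<and> t + j \<le> card (ones h \<inter> {1..t + 2 * j})" "M \<le> K"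
    and G: "G \<subseteq> sfuns {1..n} q m'" "m' \<le> K" and walk: "walks F G"
  shows "real (card F) \<le> star_size n q m t * exp \<epsilon>"
    and "\<exists>g\<in>G. \<not> {1..t} \<subseteq> ones g \<Longrightarrow>
      real (card {h \<in> F. {1..t} \<subseteq> ones h}) \<le> star_size n q m t * (\<epsilon> / 2)"
    and "\<exists>g\<in>G. \<not> {1..t} \<subseteq> ones g \<Longrightarrow>
      real (card F) \<le> star_size n q m t * (exp \<epsilon> - 1 + \<epsilon> / 2)"
proof -
  define J where "J = {j. t + j \<le> M}"
  have J: "finite J" "\<And>j. j \<in> J \<Longrightarrow> t + 2 * j \<le> 2 * K"
    using hit(2) by (auto simp: J_def intro: finite_subset[of _ "{..M}"])
  have hitJ: "\<exists>j\<in>J. t + j \<le> card (ones h \<inter> {1..t + 2 * j})" if "h \<in> F" for h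
    using hit(1) that by (auto simp: J_def)
  show "real (card F) \<le> star_size n q m t * exp \<epsilon>"
    using card_line_diagonal_le(1)[OF F J hitJ] .
  assume "\<exists>g\<in>G. \<not> {1..t} \<subseteq> ones g"
  then obtain g where g: "g \<in> G" "\<not> {1..t} \<subseteq> ones g"
    by blast
  then have g': "g \<in> sfuns {1..n} q m'"
    using G by blast
  show star: "real (card {h \<in> F. {1..t} \<subseteq> ones h}) \<le> star_size n q m t * (\<epsilon> / 2)"
  proof (rule card_star_part_le[OF F])
    show "finite (ones g)" "card (ones g) \<le> K"
      using finite_ones[OF g'] card_ones_le[OF g'] G(2) by auto
  qed (use walk g in \<open>auto simp: walks_def\<close>)
  have "real (card {h \<in> F. \<not> {1..t} \<subseteq> ones h}) \<le> star_size n q m t * (exp \<epsilon> - 1)"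
  proof (rule card_line_diagonal_le(2)[where J = "J - {0}"])
    show "{h \<in> F. \<not> {1..t} \<subseteq> ones h} \<subseteq> sfuns {1..n} q m"
      using F by blast
    fix h assume "h \<in> {h \<in> F. \<not> {1..t} \<subseteq> ones h}"
    then have h: "h \<in> F" "\<not> {1..t} \<subseteq> ones h"
      by auto
    obtain j where j: "j \<in> J" "t + j \<le> card (ones h \<inter> {1..t + 2 * j})"
      using hitJ[OF h(1)] by blast
    have "j \<noteq> 0"
    proof
      assume "j = 0"
      then have "card {1..t} \<le> card (ones h \<inter> {1..t})"
        using j by simp
      then have "ones h \<inter> {1..t} = {1..t}"
        by (intro card_seteq) auto
      then show False
        using h(2) by blast
    qed
    then show "\<exists>j\<in>J - {0}. t + j \<le> card (ones h \<inter> {1..t + 2 * j})"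
      using j by blast
  qed (use F J in auto)
  moreover have "card F = card {h \<in> F. {1..t} \<subseteq> ones h} + card {h \<in> F. \<not> {1..t} \<subseteq> ones h}"
  proof -
    have "finite F"
      using F card_sfuns finite_subset by blast
    then have "card ({h \<in> F. {1..t} \<subseteq> ones h} \<union> {h \<in> F. \<not> {1..t} \<subseteq> ones h}) =
        card {h \<in> F. {1..t} \<subseteq> ones h} + card {h \<in> F. \<not> {1..t} \<subseteq> ones h}"
      by (intro card_Un_disjoint) auto
    moreover have "{h \<in> F. {1..t} \<subseteq> ones h} \<union> {h \<in> F. \<not> {1..t} \<subseteq> ones h} = F"
      by blast
    ultimately show ?thesis
      by simp
  qed
  ultimately show "real (card F) \<le> star_size n q m t * (exp \<epsilon> - 1 + \<epsilon> / 2)"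
    using star by (simp add: algebra_simps)
qed

lemma mult_le_less:
  fixes x y a b A B :: real
  assumes "x \<le> A * a" "y \<le> B * b" "0 \<le> y" "0 \<le> a" "0 < A" "0 < B" "a * b < 1"
  shows "x * y < A * B"
proof -
  have "x * y \<le> (A * a) * (B * b)"
    using assms by (intro mult_mono) auto
  also have "\<dots> = A * B * (a * b)"
    by simp
  also have "\<dots> < A * B"
    using assms by simp
  finally show ?thesis .
qed

text \<open>
  With \<open>v = t + a\<close> the last line met by all walks of \<open>G\<close>, some walk of \<open>G\<close> misses the next line,
  which confines \<open>F\<close>; the surplus factor \<open>\<rho> ^ a\<close> in the bound for \<open>G\<close> then pays for \<open>F\<close>.
\<close>

lemma walks_bound_aux:
  assumes F: "F \<subseteq> sfuns {1..n} q m1" "t \<le> m1" "m1 \<le> K"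
    and G: "G \<subseteq> sfuns {1..n} q m2" "t \<le> m2" "m2 \<le> K" "G \<noteq> {}"
    and walk: "walks F G" and hit: "\<And>g. g \<in> G \<Longrightarrow> hits t (ones g)"
  shows "real (card F) * real (card G) < star_size n q m1 t * star_size n q m2 t \<or>
    (\<forall>h\<in>F \<union> G. {1..t} \<subseteq> ones h)"
proof -
  have posF: "0 < star_size n q m1 t" and posG: "0 < star_size n q m2 t"
    using star_size_pos F G by auto
  have fin: "finite (ones g)" "card (ones g) \<le> m2" if "g \<in> G" for g
    using that G(1) finite_ones card_ones_le by blast+
  have "\<exists>v\<ge>t. (\<forall>B\<in>ones ` G. hits v B) \<and> (\<exists>B\<in>ones ` G. \<not> hits (Suc v) B)"
    using G(4) fin hit by (intro exists_max_line) auto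
  then obtain v g0 where v: "t \<le> v" "\<And>g. g \<in> G \<Longrightarrow> hits v (ones g)"
    and g0: "g0 \<in> G" "\<not> hits (Suc v) (ones g0)"
    by blast
  have vm: "v \<le> m2"
    using hits_le_card[OF v(2)[OF g0(1)]] fin[OF g0(1)] by simp
  obtain a where a: "v = t + a"
    using v(1) le_Suc_ex by blast
  define J where "J = {j. t + a + j \<le> m2}"
  have J: "finite J" "\<And>j. j \<in> J \<Longrightarrow> t + a + 2 * j \<le> 2 * K"
    using G(3) by (auto simp: J_def intro: finite_subset[of _ "{..m2}"])
  have hitF: "\<exists>j. t + a + j \<le> m2 \<and> t + j \<le> card (ones h \<inter> {1..t + a + 2 * j})" if h: "h \<in> F" for h
  proof -
    obtain i where "i + t \<le> card (ones h \<inter> {1..i}) + card (ones g0 \<inter> {1..i})"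
      using walk h g0(1) unfolding walks_def by blast
    then show ?thesis
      using walk_avoiding_line[of i t "ones h" "ones g0" v m2] g0 v(1) vm fin[OF g0(1)] a by auto
  qed
  have hitG: "\<exists>j. t + a + j \<le> m2 \<and> t + a + j \<le> card (ones g \<inter> {1..t + a + 2 * j})" if g: "g \<in> G" for g
  proof -
    obtain j where j: "t + a + j \<le> card (ones g \<inter> {1..t + a + 2 * j})"
      using v(2)[OF g] unfolding hits_def a by blast
    moreover have "card (ones g \<inter> {1..t + a + 2 * j}) \<le> card (ones g)"
      using fin[OF g] by (intro card_mono) auto
    ultimately show ?thesis
      using fin(2)[OF g] by (intro exI[of _ j]) linarith
  qed
  note e = exp_minus_one_le exp_exp_minus_one_le
  have e0: "0 < \<epsilon>" "1 < exp \<epsilon>"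
    by auto
  show ?thesis
  proof (cases "a = 0")
    case False
    have "real (card F) * \<rho> ^ a \<le> star_size n q m1 t * (\<Sum>j\<in>J. \<epsilon> ^ (a + j) / fact (a + j))"
      using card_hitting_le[OF F(1,3) J, of 0] hitF by (auto simp: J_def)
    also have "\<dots> \<le> star_size n q m1 t * (exp \<epsilon> - 1)"
      using sum_exp_le(2)[OF J(1), of a] posF False by (intro mult_left_mono) auto
    finally have bF: "real (card F) * \<rho> ^ a \<le> star_size n q m1 t * (exp \<epsilon> - 1)" .
    have "real (card G) \<le> star_size n q m2 t * \<rho> ^ a * (\<Sum>j\<in>J. \<epsilon> ^ (0 + j) / fact (0 + j))"
      using card_hitting_le[OF G(1,3) J, of a] hitG by (auto simp: J_def)
    also have "\<dots> \<le> star_size n q m2 t * \<rho> ^ a * exp \<epsilon>"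
      using sum_exp_le(1)[OF J(1), of 0] posG \<rho> by (intro mult_left_mono) auto
    finally have "real (card G) / \<rho> ^ a \<le> star_size n q m2 t * exp \<epsilon>"
      using \<rho> by (simp add: field_simps)
    moreover have "(exp \<epsilon> - 1) * exp \<epsilon> < 1"
    proof -
      have "(exp \<epsilon> - 1) * exp \<epsilon> \<le> (39 / 25 - 1) * (39 / 25)"
        using e e0 by (intro mult_mono) auto
      then show ?thesis
        by simp
    qed
    ultimately have "(real (card F) * \<rho> ^ a) * (real (card G) / \<rho> ^ a) <
        star_size n q m1 t * star_size n q m2 t"
      using bF posF posG \<rho> e0 by (intro mult_le_less) auto
    then show ?thesis
      using \<rho> by simp
  next
    case True
    have hitF': "\<forall>h\<in>F. \<exists>j. t + j \<le> m2 \<and> t + j \<le> card (ones h \<inter> {1..t + 2 * j})"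
      using hitF True by simp
    have hitG': "\<forall>h\<in>G. \<exists>j. t + j \<le> m2 \<and> t + j \<le> card (ones h \<inter> {1..t + 2 * j})"
      using hitG True by simp
    note bF = card_diagonal_le[OF F(1,3) hitF' G(3) G(1,3) walk]
    note bG = card_diagonal_le[OF G(1,3) hitG' G(3) F(1,3) walks_sym[OF walk]]
    have half: "\<epsilon> / 2 * exp \<epsilon> < 1"
    proof -
      have "\<epsilon> / 2 * exp \<epsilon> \<le> (2 / 5) / 2 * (39 / 25)"
        using e e0 by (intro mult_mono) auto
      then show ?thesis
        by simp
    qed
    have both: "(exp \<epsilon> - 1 + \<epsilon> / 2) * (exp \<epsilon> - 1 + \<epsilon> / 2) < 1"
    proof -
      have "(exp \<epsilon> - 1 + \<epsilon> / 2) * (exp \<epsilon> - 1 + \<epsilon> / 2) \<le>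
          (39 / 25 - 1 + (2 / 5) / 2) * (39 / 25 - 1 + (2 / 5) / 2)"
        using e e0 by (intro mult_mono) auto
      also have "\<dots> < 1"
        by simp
      finally show ?thesis .
    qed
    \<comment> \<open>If only one family leaves the star on \<open>{1..t}\<close>, the other lies
      wholly inside it and has factor \<open>\<epsilon> / 2\<close>, against at most
      \<open>exp \<epsilon>\<close>. If both leave it, each factor is at most 14 / 25 + 1 / 5 = 19 /
      25.\<close>
    consider (stars) "\<forall>h\<in>F \<union> G. {1..t} \<subseteq> ones h"
      | (F) "\<forall>h\<in>F. {1..t} \<subseteq> ones h" "\<exists>g\<in>G. \<not> {1..t} \<subseteq> ones g"
      | (G) "\<forall>g\<in>G. {1..t} \<subseteq> ones g" "\<exists>h\<in>F. \<not> {1..t} \<subseteq> ones h"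
      | (none) "\<exists>h\<in>F. \<not> {1..t} \<subseteq> ones h" "\<exists>g\<in>G. \<not> {1..t} \<subseteq> ones g"
      by blast
    then show ?thesis
    proof cases
      case stars
      then show ?thesis
        by blast
    next
      case F
      then have "{h \<in> F. {1..t} \<subseteq> ones h} = F"
        by blast
      then show ?thesis
        using bF(2)[OF F(2)] bG(1) half posF posG e0
        by (intro disjI1 mult_le_less[where a = "\<epsilon> / 2" and b = "exp \<epsilon>"]) auto
    next
      case G
      then have "{h \<in> G. {1..t} \<subseteq> ones h} = G"
        by blast
      then show ?thesis
        using bG(2)[OF G(2)] bF(1) half posF posG e0
        by (intro disjI1 mult_le_less[where b = "\<epsilon> / 2" and a = "exp \<epsilon>"]) (auto simp: mult.commute)
    next
      case none
      then show ?thesis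
        using bF(3) bG(3) both posF posG e0
        by (intro disjI1 mult_le_less[where a = "exp \<epsilon> - 1 + \<epsilon> / 2" and b = "exp \<epsilon> - 1 + \<epsilon> / 2"]) auto
    qed
  qed
qed

text \<open>One walk of \<open>G\<close> missing the line y = x + t forces every walk of
  \<open>F\<close> to meet it, so the preceding estimate applies after exchanging the families if
  necessary.\<close>

lemma walks_bound:
  assumes F: "F \<subseteq> sfuns {1..n} q m1" "t \<le> m1" "m1 \<le> K"
    and G: "G \<subseteq> sfuns {1..n} q m2" "t \<le> m2" "m2 \<le> K"
    and walk: "walks F G"
  shows "real (card F) * real (card G) < star_size n q m1 t * star_size n q m2 t \<or>
    (\<forall>h\<in>F \<union> G. {1..t} \<subseteq> ones h)"
proof (cases "F = {} \<or> G = {}")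
  case True
  then show ?thesis
    using star_size_pos[OF F(2,3)] star_size_pos[OF G(2,3)] by auto
next
  case False
  show ?thesis
  proof (cases "\<forall>g\<in>G. hits t (ones g)")
    case True
    then show ?thesis
      using walks_bound_aux[OF F G _ walk] False by blast
  next
    case not: False
    then obtain g where g: "g \<in> G" "\<not> hits t (ones g)"
      by blast
    have "hits t (ones h)" if h: "h \<in> F" for h
    proof -
      obtain i where "i + t \<le> card (ones h \<inter> {1..i}) + card (ones g \<inter> {1..i})"
        using walk h g(1) unfolding walks_def by blast
      then show ?thesis
        using walk_hits g(2) by blast
    qed
    then show ?thesis
      using walks_bound_aux[OF G F _ walks_sym[OF walk]] False by (simp add: mult.commute Un_commute)
  qed
qed

end

section \<open>Position and value shifts\<close>

text \<open>The swap permutes the agreement set rather than fixing it, but only its size enters the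
  cross condition. This is the self-adjointness needed for shifting.\<close>

lemma card_agree_comp_transpose:
  "card (agree V (h \<circ> transpose i j) g) = card (agree V h (g \<circ> transpose i j))"
proof -
  have "agree V (h \<circ> transpose i j) g = transpose i j ` agree V h (g \<circ> transpose i j)"
    by (auto simp: agree_def in_transpose_image_iff)
  then show ?thesis
    by (simp add: card_image)
qed

lemma support_comp_transpose: "{x. (h \<circ> transpose i j) x \<noteq> (0::nat)} = transpose i j ` {x. h x \<noteq> 0}"
  by (auto simp: in_transpose_image_iff)

lemma transpose_image_subset: "i \<in> D \<Longrightarrow> j \<in> D \<Longrightarrow> A \<subseteq> D \<Longrightarrow> transpose i j ` A \<subseteq> D"
  by (auto simp: transpose_def)

lemma sfuns_comp_transpose:
  assumes "h \<in> sfuns D q m" "i \<in> D" "j \<in> D"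
  shows "h \<circ> transpose i j \<in> sfuns D q m"
proof -
  have "transpose i j ` {x. h x \<noteq> 0} \<subseteq> D"
    using assms by (intro transpose_image_subset) (auto simp: sfuns_def)
  then show ?thesis
    using assms unfolding sfuns_def mem_Collect_eq support_comp_transpose by (simp add: card_image)
qed

lemma star_comp_transpose:
  assumes "i \<in> {1..n}" "j \<in> {1..n}"
  shows "(\<lambda>h. h \<circ> transpose i j) ` star n q m X c = star n q m (transpose i j ` X) (c \<circ> transpose i j)"
proof (intro equalityI subsetI)
  fix h assume "h \<in> (\<lambda>h. h \<circ> transpose i j) ` star n q m X c"
  then show "h \<in> star n q m (transpose i j ` X) (c \<circ> transpose i j)"
    using assms by (auto simp: star_def sfuns_comp_transpose)
next
  fix h assume h: "h \<in> star n q m (transpose i j ` X) (c \<circ> transpose i j)"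
  then have "h \<circ> transpose i j \<in> star n q m X c"
    using assms by (auto simp: star_def sfuns_comp_transpose)
  then show "h \<in> (\<lambda>h. h \<circ> transpose i j) ` star n q m X c"
    by (intro image_eqI[of _ _ "h \<circ> transpose i j"]) (simp_all add: comp_assoc)
qed

lemma ones_comp_transpose:
  "h j = 1 \<Longrightarrow> h i \<noteq> 1 \<Longrightarrow> ones (h \<circ> transpose i j) = insert i (ones h - {j})"
  by (auto simp: ones_def transpose_def)

lemma agree_one: "agree {1} h g = ones h \<inter> ones g"
  by (auto simp: agree_def ones_def)

text \<open>Only \<open>j\<close> can be lost from the common ones, and then \<open>g j = 1\<close>.
  As \<open>g\<close> is not movable, also \<open>g i = 1\<close>, so \<open>i\<close> is gained in
  exchange.\<close>

lemma card_agree_one_mono: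
  assumes "h j = 1" "h i \<noteq> 1" "\<not> (g j = 1 \<and> g i \<noteq> 1)" "finite (ones h)"
  shows "card (agree {1} h g) \<le> card (agree {1} (h \<circ> transpose i j) g)"
proof -
  have h: "i \<notin> ones h" "j \<in> ones h"
    using assms by (auto simp: ones_def)
  have A: "agree {1} (h \<circ> transpose i j) g = insert i (ones h - {j}) \<inter> ones g"
    unfolding agree_one ones_comp_transpose[where h = h and i = i and j = j, OF assms(1,2)] ..
  show ?thesis
  proof (cases "g i = 1")
    case True
    then have "agree {1} (h \<circ> transpose i j) g = insert i (ones h \<inter> ones g - {j})"
      unfolding A by (auto simp: ones_def)
    then have "card (agree {1} (h \<circ> transpose i j) g) = Suc (card (ones h \<inter> ones g - {j}))"
      using h assms(4) by simp
    moreover have "card (ones h \<inter> ones g) \<le> Suc (card (ones h \<inter> ones g - {j}))"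
    proof (cases "j \<in> ones g")
      case True
      then have "Suc (card (ones h \<inter> ones g - {j})) = card (ones h \<inter> ones g)"
        using h assms(4) by (intro card_Suc_Diff1) auto
      then show ?thesis
        by linarith
    qed simp
    ultimately show ?thesis
      unfolding agree_one by simp
  next
    case False
    then have "j \<notin> ones g"
      using assms(3) by (auto simp: ones_def)
    then have "agree {1} h g \<subseteq> agree {1} (h \<circ> transpose i j) g"
      unfolding A unfolding agree_one by auto
    then show ?thesis
      using assms(4) A by (intro card_mono) auto
  qed
qed

lemma sum_ones_transpose_less:
  assumes "h j = 1" "h i \<noteq> 1" "i < j" "finite (ones h)"
  shows "\<Sum>(ones (h \<circ> transpose i j)) < \<Sum>(ones h)"
proof -
  have "i \<notin> ones h" "j \<in> ones h"
    using assms by (auto simp: ones_def)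
  then show ?thesis
    unfolding ones_comp_transpose[where h = h and i = i and j = j, OF assms(1,2)]
    using assms(3,4) by (simp add: sum.remove[of "ones h" j])
qed

section \<open>Exchanging the values 1 and v at one position\<close>

definition flip :: "nat \<Rightarrow> nat \<Rightarrow> (nat \<Rightarrow> nat) \<Rightarrow> nat \<Rightarrow> nat" where
  "flip x v h = h(x := transpose 1 v (h x))"

lemma flip_flip [simp]: "flip x v (flip x v h) = h"
  by (simp add: flip_def)

lemma support_flip: "v \<ge> 1 \<Longrightarrow> flip x v h y \<noteq> 0 \<longleftrightarrow> h y \<noteq> 0"
  by (auto simp: flip_def transpose_def)

lemma sfuns_flip:
  assumes "h \<in> sfuns D q m" "v \<ge> 1" "v \<le> q"
  shows "flip x v h \<in> sfuns D q m"
proof -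
  have "flip x v h y \<le> q" for y
    using sfuns_le[OF assms(1), of y] assms(2,3) by (auto simp: flip_def transpose_def)
  then show ?thesis
    using assms(1) unfolding sfuns_def mem_Collect_eq support_flip[OF assms(2)] by blast
qed

lemma star_flip_subset:
  assumes "v \<ge> 1" "v \<le> q" "x \<in> X"
  shows "flip x v ` star n q m X c \<subseteq> star n q m X (flip x v c)"
  using assms by (auto simp: star_def sfuns_flip) (auto simp: flip_def)

lemma star_flip:
  assumes "v \<ge> 1" "v \<le> q" "x \<in> X"
  shows "flip x v ` star n q m X c = star n q m X (flip x v c)"
proof
  show "star n q m X (flip x v c) \<subseteq> flip x v ` star n q m X c"
  proof
    fix h assume "h \<in> star n q m X (flip x v c)"
    then have "flip x v h \<in> star n q m X c"
      using star_flip_subset[OF assms, of n m "flip x v c"] by auto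
    then show "h \<in> flip x v ` star n q m X c"
      by (intro image_eqI[of _ _ "flip x v h"]) simp_all
  qed
qed (rule star_flip_subset[OF assms])

lemma agree_flip: "v \<ge> 1 \<Longrightarrow> agree {0<..} (flip x v h) g = agree {0<..} h (flip x v g)"
  by (auto simp: agree_def flip_def transpose_def split: if_splits)

text \<open>The function changes only at \<open>x\<close>, where there was no agreement to
  lose.\<close>

lemma agree_flip_mono:
  "v \<ge> 1 \<Longrightarrow> h x = v \<Longrightarrow> g x \<noteq> v \<Longrightarrow> agree {0<..} h g \<subseteq> agree {0<..} (flip x v h) g"
  by (auto simp: agree_def flip_def)

section \<open>Members that tell a star from its swap\<close>

context signed_range
begin

text \<open>If q = 2 and n + t \<le> 2 K, then t < K because K < n. Now \<open>bound\<close> gives n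
  - t \<ge> e (K - t) K \<ge> 4 (K - t), against n - t \<le> 2 (K - t).\<close>

lemma room: "q \<ge> 3 \<or> 2 * K + 1 \<le> n + t"
proof (rule ccontr)
  assume "\<not> ?thesis"
  then have q: "q = 2" and n: "n + t \<le> 2 * K"
    using q_ge by auto
  then have "t < K"
    using K_less t_le by linarith
  then have K: "real K - real t \<ge> 1" "real K \<ge> 2"
    using t_pos by auto
  have "exp (1::real) \<ge> 2"
    using exp_ge_add_one_self[of 1] by simp
  then have "2 * (real K - real t) * 2 \<le> exp 1 * (real K - real t) * real K"
    using K by (intro mult_mono) auto
  also have "\<dots> \<le> real n - real t"
    using bound q by simp
  finally show False
    using of_nat_mono[OF n, where 'a = real] K by simp
qed

lemma avoid:
  assumes "X \<subseteq> Y" "Y \<subseteq> {1..n}" "card X = t" "card Y \<le> t + 1" "c \<in> X \<rightarrow> {1..q}"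
    and "t \<le> m2" "m1 \<le> K" "m2 \<le> K" "h1 \<in> star n q m1 X c" "h2 \<in> star n q m1 X c"
  obtains g where "g \<in> star n q m2 X c" "\<And>y. y \<in> Y - X \<Longrightarrow> g y = 0"
    "\<And>y. y \<notin> X \<Longrightarrow> g y \<noteq> 0 \<Longrightarrow> g y \<noteq> h1 y \<and> g y \<noteq> h2 y"
  using exists_star_avoiding[OF assms(1-8) K_less q_ge room assms(9,10)] by blast

definition below :: "nat \<Rightarrow> nat \<Rightarrow> (nat \<Rightarrow> nat) set \<Rightarrow> (nat \<Rightarrow> nat) set \<Rightarrow> bool" where
  "below m1 m2 F G \<longleftrightarrow> real (card F) * real (card G) < star_size n q m1 t * star_size n q m2 t"

text \<open>Since the swap takes \<open>h\<close> out of the star, \<open>h j\<close> is not 1, so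
  \<open>j\<close> is no common one; at \<open>i\<close> the swapped \<open>g\<close> has the value
  \<open>g j = 0\<close>. Other positions outside \<open>X\<close> are excluded by the choice of
  \<open>g\<close>, which leaves at most t - 1.\<close>

lemma transpose_not_agree:
  assumes X: "X \<subseteq> {1..n}" "card X = t" and ij: "i \<in> X" "j \<notin> X" "j \<in> {1..n}"
    and h: "h \<in> star n q m1 X (\<lambda>_. 1)" "h \<circ> transpose i j \<notin> star n q m1 X (\<lambda>_. 1)"
    and g: "g \<in> star n q m2 X (\<lambda>_. 1)" "g j = 0" "\<And>y. y \<notin> X \<Longrightarrow> g y \<noteq> 0 \<Longrightarrow> g y \<noteq> h y"
  shows "\<not> t \<le> card (agree {1} h (g \<circ> transpose i j))"
proof -
  have i: "i \<in> {1..n}"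
    using X ij by blast
  have hj: "h j \<noteq> 1"
  proof
    assume "h j = 1"
    then have "(h \<circ> transpose i j) x = 1" if "x \<in> X" for x
      using h(1) that ij by (auto simp: star_def transpose_def)
    then show False
      using h ij i by (auto simp: star_def sfuns_comp_transpose)
  qed
  have "agree {1} h (g \<circ> transpose i j) \<subseteq> X - {i}"
  proof
    fix y assume y: "y \<in> agree {1} h (g \<circ> transpose i j)"
    then have "y \<noteq> i" "y \<noteq> j"
      using hj g(2) by (auto simp: agree_def)
    then show "y \<in> X - {i}"
      using y g(3)[of y] by (auto simp: agree_def)
  qed
  moreover have fin: "finite X"
    using X by (rule_tac finite_subset) auto
  ultimately have "card (agree {1} h (g \<circ> transpose i j)) \<le> card (X - {i})"
    by (intro card_mono) auto
  also have "\<dots> < card X"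
    using fin ij by (intro card_Diff1_less)
  finally show ?thesis
    using X by simp
qed

text \<open>At \<open>x\<close> the flipped \<open>g\<close> has the value \<open>v\<close> while
  \<open>h\<close> has 1, and outside \<open>X\<close> the two do not agree either, so at most t - 1
  positions remain.\<close>

lemma flip_not_agree:
  assumes X: "X \<subseteq> {1..n}" "card X = t" and x: "x \<in> X" "c x = 1" and v: "v \<ge> 2"
    and h: "h \<in> star n q m1 X c"
    and g: "g \<in> star n q m2 X c" "\<And>y. y \<notin> X \<Longrightarrow> g y \<noteq> 0 \<Longrightarrow> g y \<noteq> h y"
  shows "\<not> t \<le> card (agree {0<..} h (flip x v g))"
proof -
  have "h x = 1" "g x = 1"
    using h g x by (auto simp: star_def)
  then have "agree {0<..} h (flip x v g) \<subseteq> X - {x}"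
    using v g(2) by (fastforce simp: agree_def flip_def split: if_splits)
  moreover have fin: "finite X"
    using X by (rule_tac finite_subset) auto
  ultimately have "card (agree {0<..} h (flip x v g)) \<le> card (X - {x})"
    by (intro card_mono) auto
  also have "\<dots> < card X"
    using fin x by (intro card_Diff1_less)
  finally show ?thesis
    using X by simp
qed

text \<open>Once only common values 1 count, shifting towards smaller positions preserves the cross
  \<open>t\<close>-intersection property; it need not do so for arbitrary common values.\<close>

lemma cross_ones_bound:
  assumes m: "t \<le> m1" "m1 \<le> K" "t \<le> m2" "m2 \<le> K"
    and F: "F \<subseteq> sfuns {1..n} q m1" and G: "G \<subseteq> sfuns {1..n} q m2"
    and cross: "\<And>h g. h \<in> F \<Longrightarrow> g \<in> G \<Longrightarrow> t \<le> card (agree {1} h g)"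
  shows "below m1 m2 F G \<or> (\<exists>X. X \<subseteq> {1..n} \<and> card X = t \<and>
    F = star n q m1 X (\<lambda>_. 1) \<and> G = star n q m2 X (\<lambda>_. 1))"
proof -
  define \<sigma> :: "nat \<times> nat \<Rightarrow> (nat \<Rightarrow> nat) \<Rightarrow> nat \<Rightarrow> nat"
    where "\<sigma> s h = h \<circ> transpose (fst s) (snd s)" for s h
  define mov :: "nat \<times> nat \<Rightarrow> (nat \<Rightarrow> nat) \<Rightarrow> bool"
    where "mov s h \<longleftrightarrow> h (snd s) = 1 \<and> h (fst s) \<noteq> 1" for s h
  define I where "I = {(i, j). 1 \<le> i \<and> i < j \<and> j \<le> n}"
  define Q where "Q F G \<longleftrightarrow> F \<subseteq> sfuns {1..n} q m1 \<and> G \<subseteq> sfuns {1..n} q m2 \<and>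
    (\<forall>h\<in>F. \<forall>g\<in>G. t \<le> card (agree {1} h g))" for F G
  have inv: "\<sigma> s (\<sigma> s h) = h" for s h
    by (simp add: \<sigma>_def comp_assoc)
  have mov: "\<forall>h. mov s h \<longrightarrow> \<not> mov s (\<sigma> s h)" for s
    by (auto simp: mov_def \<sigma>_def)
  have adj: "t \<le> card (agree {1} (\<sigma> s h) g) \<longleftrightarrow> t \<le> card (agree {1} h (\<sigma> s g))" for s h g
    by (simp add: \<sigma>_def card_agree_comp_transpose)
  have sf: "\<sigma> s h \<in> sfuns {1..n} q m" if "s \<in> I" "h \<in> sfuns {1..n} q m" for s h m
    using that by (auto simp: I_def \<sigma>_def intro!: sfuns_comp_transpose)
  have fin: "finite F \<and> finite G" if "Q F G" for F G
    using that card_sfuns finite_subset unfolding Q_def by (meson finite_atLeastAtMost)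
  show ?thesis
  proof (rule shift_induct[where Q = Q and \<sigma> = \<sigma> and mov = mov and I = I and w = "\<lambda>h. \<Sum>(ones h)"])
    show "Q F G"
      using F G cross by (auto simp: Q_def)
  next
    fix F G s h
    assume Q: "Q F G" and s: "s \<in> I" and h: "h \<in> F \<union> G" "mov s h"
    then have "finite (ones h)"
      using finite_ones by (auto simp: Q_def)
    then show "\<Sum>(ones (\<sigma> s h)) < \<Sum>(ones h)"
      using s h(2) unfolding \<sigma>_def by (intro sum_ones_transpose_less) (auto simp: I_def mov_def)
  next
    fix F G s
    assume Q: "Q F G" and s: "s \<in> I"
    have cr: "t \<le> card (agree {1} h g)" if "h \<in> F" "g \<in> G" for h g
      using that Q by (simp add: Q_def)
    have mono: "t \<le> card (agree {1} (\<sigma> s h) g)"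
      if "mov s h" "\<not> mov s g" "h \<in> F \<union> G" "t \<le> card (agree {1} h g)" for h g
    proof -
      have "finite (ones h)"
        using that Q finite_ones by (auto simp: Q_def)
      then show ?thesis
        using card_agree_one_mono[of h "snd s" "fst s" g] that by (simp add: mov_def \<sigma>_def)
    qed
    have "t \<le> card (agree {1} h g)" if "h \<in> shift (\<sigma> s) (mov s) F" "g \<in> shift (\<sigma> s) (mov s) G" for h g
    proof (rule shift_cross[where R = "\<lambda>h g. t \<le> card (agree {1} h g)", OF cr inv[of s] adj[of s] _ _ that])
      fix h g assume "h \<in> F" "g \<in> G" "\<not> mov s h" "mov s g" "t \<le> card (agree {1} h g)"
      then show "t \<le> card (agree {1} h (\<sigma> s g))"
        using mono[of g h] by (simp add: agree_commute)
    qed (use mono in auto)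
    then show "Q (shift (\<sigma> s) (mov s) F) (shift (\<sigma> s) (mov s) G)"
      using Q shift_subset sf[OF s] unfolding Q_def by (metis (no_types, lifting))
  next
    fix F G s
    assume Q: "Q F G" and s: "s \<in> I"
      and concl: "below m1 m2 (shift (\<sigma> s) (mov s) F) (shift (\<sigma> s) (mov s) G) \<or>
        (\<exists>X. X \<subseteq> {1..n} \<and> card X = t \<and> shift (\<sigma> s) (mov s) F = star n q m1 X (\<lambda>_. 1) \<and>
          shift (\<sigma> s) (mov s) G = star n q m2 X (\<lambda>_. 1))"
    note finFG = conjunct1[OF fin[OF Q]] conjunct2[OF fin[OF Q]]
    have cr: "t \<le> card (agree {1} h g)" if "h \<in> F" "g \<in> G" for h g
      using that Q by (simp add: Q_def)
    obtain i j where ij: "s = (i, j)" "1 \<le> i" "i < j" "j \<le> n"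
      using s by (auto simp: I_def)
    show "below m1 m2 F G \<or> (\<exists>X. X \<subseteq> {1..n} \<and> card X = t \<and>
      F = star n q m1 X (\<lambda>_. 1) \<and> G = star n q m2 X (\<lambda>_. 1))"
      using concl
    proof (elim disjE exE conjE)
      assume "below m1 m2 (shift (\<sigma> s) (mov s) F) (shift (\<sigma> s) (mov s) G)"
      then show ?thesis
        using card_shift[OF finFG(1) inv[of s]] card_shift[OF finFG(2) inv[of s]] by (simp add: below_def)
    next
      fix X assume X: "X \<subseteq> {1..n}" "card X = t"
        and S: "shift (\<sigma> s) (mov s) F = star n q m1 X (\<lambda>_. 1)"
          "shift (\<sigma> s) (mov s) G = star n q m2 X (\<lambda>_. 1)"
      have one: "(\<lambda>_. 1) \<in> X \<rightarrow> {1..q}"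
        using q_ge by simp
      show ?thesis
      \<comment> \<open>A move from \<open>j\<close> to \<open>i\<close> can have created this star
        only if its centre contains \<open>i\<close> but not \<open>j\<close>; otherwise the star is
        closed under the reverse move.\<close>
      proof (cases "i \<in> X \<and> j \<notin> X")
        case False
        have "\<sigma> s h \<in> star n q m X (\<lambda>_. 1)" if h: "h \<in> star n q m X (\<lambda>_. 1)" "mov s (\<sigma> s h)" for h m
        proof -
          have "h i = 1" "h j \<noteq> 1"
            using h(2) ij by (auto simp: mov_def \<sigma>_def)
          then have "i \<notin> X" "j \<notin> X"
            using False h(1) by (auto simp: star_def)
          then show ?thesis
            using h(1) sf[OF s] ij(1) by (auto simp: star_def \<sigma>_def transpose_def)
        qed
        then show ?thesis
          using shift_eq_trivial[OF finFG(1) inv[of s] mov S(1)] shift_eq_trivial[OF finFG(2) inv[of s] mov S(2)] X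
          by blast
      next
        case True
        \<comment> \<open>The witness has to vanish at \<open>j\<close> too, so that its swap
          vanishes at \<open>i\<close> and leaves the star. This is the one position beyond
          \<open>X\<close> that \<open>avoid\<close> admits.\<close>
        have Y: "X \<subseteq> insert j X" "insert j X \<subseteq> {1..n}" "card (insert j X) \<le> t + 1"
          using X ij finite_subset[OF X(1)] by (auto simp: card_insert_if)
        have j: "j \<in> {1..n}" "i \<in> {1..n}"
          using ij by auto
        have av: "\<exists>g\<in>star n q m' X (\<lambda>_. 1). \<sigma> s g \<notin> star n q m' X (\<lambda>_. 1) \<and>
            \<not> t \<le> card (agree {1} h1 (\<sigma> s g)) \<and> \<not> t \<le> card (agree {1} h2 (\<sigma> s g))"
          if m: "t \<le> m'" "m' \<le> K" "m \<le> K"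
            and h: "h1 \<in> star n q m X (\<lambda>_. 1)" "\<sigma> s h1 \<notin> star n q m X (\<lambda>_. 1)"
            "h2 \<in> star n q m X (\<lambda>_. 1)" "\<sigma> s h2 \<notin> star n q m X (\<lambda>_. 1)" for m m' h1 h2
        proof -
          obtain g where g: "g \<in> star n q m' X (\<lambda>_. 1)" "\<And>y. y \<in> insert j X - X \<Longrightarrow> g y = 0"
            "\<And>y. y \<notin> X \<Longrightarrow> g y \<noteq> 0 \<Longrightarrow> g y \<noteq> h1 y \<and> g y \<noteq> h2 y"
            using avoid[OF Y(1,2) X(2) Y(3) one m(1,3,2) h(1,3)] by blast
          have gj: "g j = 0"
            using g(2) True by simp
          have "\<sigma> s g i = 0"
            using gj ij(1) by (simp add: \<sigma>_def)
          then have "\<sigma> s g \<notin> star n q m' X (\<lambda>_. 1)"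
            using True unfolding star_def by fastforce
          moreover have "\<not> t \<le> card (agree {1} h1 (\<sigma> s g))" "\<not> t \<le> card (agree {1} h2 (\<sigma> s g))"
            using transpose_not_agree[OF X _ _ j(1) _ _ g(1) gj] True h g(3) ij(1)
            by (auto simp: \<sigma>_def)
          ultimately show ?thesis
            using g(1) by blast
        qed
        have sg: "t \<le> card (agree {1} h g) \<longleftrightarrow> t \<le> card (agree {1} g h)" for h g
          by (simp add: agree_commute)
        have "F = star n q m1 X (\<lambda>_. 1) \<and> G = star n q m2 X (\<lambda>_. 1) \<or>
            F = \<sigma> s ` star n q m1 X (\<lambda>_. 1) \<and> G = \<sigma> s ` star n q m2 X (\<lambda>_. 1)"
        proof (rule shift_eq_back[where R = "\<lambda>h g. t \<le> card (agree {1} h g)", OF finFG inv[of s] mov S cr adj[of s]])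
          fix g assume "g \<in> star n q m2 X (\<lambda>_. 1)" "\<sigma> s g \<notin> star n q m2 X (\<lambda>_. 1)"
          then obtain h where "h \<in> star n q m1 X (\<lambda>_. 1)" "\<sigma> s h \<notin> star n q m1 X (\<lambda>_. 1)"
            "\<not> t \<le> card (agree {1} g (\<sigma> s h))"
            using av[OF m(1,2,4)] by blast
          then show "\<exists>h\<in>star n q m1 X (\<lambda>_. 1). \<sigma> s h \<notin> star n q m1 X (\<lambda>_. 1) \<and>
              \<not> t \<le> card (agree {1} h (\<sigma> s g))"
            using adj sg by blast
        next
          fix h1 h2
          assume "h1 \<in> star n q m1 X (\<lambda>_. 1)" "\<sigma> s h1 \<notin> star n q m1 X (\<lambda>_. 1)"
            "h2 \<in> star n q m1 X (\<lambda>_. 1)" "\<sigma> s h2 \<notin> star n q m1 X (\<lambda>_. 1)"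
          then show "\<exists>g\<in>star n q m2 X (\<lambda>_. 1). \<sigma> s g \<notin> star n q m2 X (\<lambda>_. 1) \<and>
              \<not> t \<le> card (agree {1} h1 (\<sigma> s g)) \<and> \<not> t \<le> card (agree {1} h2 (\<sigma> s g))"
            by (rule av[OF m(3,4,2)])
        qed
        moreover have "\<sigma> s ` star n q m X (\<lambda>_. 1) = star n q m (transpose i j ` X) (\<lambda>_. 1)" for m
          using star_comp_transpose[OF j(2,1), of q m X "\<lambda>_. 1"] ij(1)
          by (simp add: \<sigma>_def comp_def)
        moreover have "transpose i j ` X \<subseteq> {1..n}" "card (transpose i j ` X) = t"
          using transpose_image_subset[OF j(2,1) X(1)] X(2) by (auto simp: card_image)
        ultimately show ?thesis
          using X by metis
      qed
    qed
  next
    fix F G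
    assume Q: "Q F G" and stF: "\<And>s h. s \<in> I \<Longrightarrow> h \<in> F \<Longrightarrow> mov s h \<Longrightarrow> \<sigma> s h \<in> F"
    have sub: "F \<subseteq> sfuns {1..n} q m1" "G \<subseteq> sfuns {1..n} q m2"
      using Q by (auto simp: Q_def)
    have "shifted (ones ` F)"
      unfolding shifted_def
    proof (intro ballI allI impI)
      fix A i j assume "A \<in> ones ` F" and ij: "1 \<le> i" "i < j" "j \<in> A" "i \<notin> A"
      then obtain h where h: "h \<in> F" "A = ones h"
        by blast
      have "j \<le> n"
        using ones_subset h ij(3) sub(1) by fastforce
      then have "\<sigma> (i, j) h \<in> F"
        using h ij by (intro stF) (auto simp: I_def mov_def ones_def)
      moreover have "ones (\<sigma> (i, j) h) = insert i (A - {j})"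
        using ones_comp_transpose[of h j i] h ij by (simp add: \<sigma>_def ones_def)
      ultimately show "insert i (A - {j}) \<in> ones ` F"
        by (metis imageI)
    qed
    moreover have "finite (ones h) \<and> 0 \<notin> ones h" if "h \<in> F" for h
      using that sub(1) finite_ones ones_subset by fastforce
    moreover have "finite (ones g)" if "g \<in> G" for g
      using that sub(2) finite_ones by blast
    ultimately have "walks F G"
      using Q t_pos unfolding walks_def Q_def agree_one
      by (intro ballI shifted_cross_walk[where \<A> = "ones ` F"]) auto
    then consider "below m1 m2 F G" | "\<forall>h\<in>F \<union> G. {1..t} \<subseteq> ones h"
      using walks_bound[OF sub(1) m(1,2) sub(2) m(3,4)] by (auto simp: below_def)
    then show "below m1 m2 F G \<or> (\<exists>X. X \<subseteq> {1..n} \<and> card X = t \<and>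
      F = star n q m1 X (\<lambda>_. 1) \<and> G = star n q m2 X (\<lambda>_. 1))"
    proof cases
      case 1
      then show ?thesis ..
    next
      case 2
      let ?S = "\<lambda>m. star n q m {1..t} (\<lambda>_. 1)"
      have S: "F \<subseteq> ?S m1" "G \<subseteq> ?S m2"
        using 2 sub by (auto simp: star_def ones_def)
      have tn: "{1..t} \<subseteq> {1..n}"
        using t_le K_less by auto
      have cS: "real (card (?S m)) = star_size n q m t" if "t \<le> m" for m
        using card_star[OF tn, of t m "\<lambda>_. 1" q] q_ge that by (simp add: star_size_def)
      have fS: "finite (?S m)" for m
        using card_sfuns(1)[of "{1..n}" q m] star_subset by (rule_tac finite_subset) auto
      have pos: "0 < star_size n q m1 t" "0 < star_size n q m2 t"
        using star_size_pos m by auto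
      have le: "real (card F) \<le> star_size n q m1 t" "real (card G) \<le> star_size n q m2 t"
        using card_mono[OF fS S(1)] card_mono[OF fS S(2)] cS[OF m(1)] cS[OF m(3)] by linarith+
      show ?thesis
      proof (cases "F = ?S m1 \<and> G = ?S m2")
        case True
        then show ?thesis
          using tn by (intro disjI2 exI[of _ "{1..t}"]) simp
      next
        case False
        then consider "F \<subset> ?S m1" | "G \<subset> ?S m2"
          using S by blast
        then show ?thesis
        proof cases
          case 1
          then have lt: "real (card F) < star_size n q m1 t"
            using psubset_card_mono[OF fS 1] cS[OF m(1)] by linarith
          have "real (card F) * real (card G) \<le> real (card F) * star_size n q m2 t"
            using le by (intro mult_left_mono) auto
          also have "\<dots> < star_size n q m1 t * star_size n q m2 t"
            using lt pos by (intro mult_strict_right_mono)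
          finally have "real (card F) * real (card G) < star_size n q m1 t * star_size n q m2 t" .
          then show ?thesis
            by (simp add: below_def)
        next
          case 2
          then have lt: "real (card G) < star_size n q m2 t"
            using psubset_card_mono[OF fS 2] cS[OF m(3)] by linarith
          have "real (card F) * real (card G) \<le> star_size n q m1 t * real (card G)"
            using le by (intro mult_right_mono) auto
          also have "\<dots> < star_size n q m1 t * star_size n q m2 t"
            using lt pos by (intro mult_strict_left_mono)
          finally have "real (card F) * real (card G) < star_size n q m1 t * star_size n q m2 t" .
          then show ?thesis
            by (simp add: below_def)
        qed
      qed
    qed
  qed (use fin inv in auto)
qed

end

section \<open>Transfer to signed sets\<close>

lemma set_to_sfun_star:
  assumes "f\<^sub>0 \<in> X \<rightarrow>\<^sub>E {1..q}"
  shows "to_sfun ` {(A, f) \<in> signed_sets n m q. X \<subseteq> A \<and> restrict f X = f\<^sub>0} = star n q m X f\<^sub>0"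
proof -
  have bij: "to_sfun ` signed_sets n m q = sfuns {1..n} q m"
    using bij_betw_to_sfun[of "{1..n}" m q] by (simp add: bij_betw_def signed_sets_def)
  have iff: "X \<subseteq> A \<and> restrict f X = f\<^sub>0 \<longleftrightarrow> (\<forall>x\<in>X. to_sfun (A, f) x = f\<^sub>0 x)" for A f
  proof
    assume *: "X \<subseteq> A \<and> restrict f X = f\<^sub>0"
    then have "f x = f\<^sub>0 x" if "x \<in> X" for x
      using that by (metis restrict_apply')
    then show "\<forall>x\<in>X. to_sfun (A, f) x = f\<^sub>0 x"
      using * by (auto simp: to_sfun_def)
  next
    assume *: "\<forall>x\<in>X. to_sfun (A, f) x = f\<^sub>0 x"
    have "x \<in> A \<and> f x = f\<^sub>0 x" if "x \<in> X" for x
    proof -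
      have "f\<^sub>0 x \<in> {1..q}"
        using assms that by (auto simp: PiE_iff)
      then show ?thesis
        using * that by (auto simp: to_sfun_def split: if_splits)
    qed
    moreover from this have "restrict f X = f\<^sub>0"
      using assms by (auto simp: fun_eq_iff restrict_def PiE_iff extensional_def)
    ultimately show "X \<subseteq> A \<and> restrict f X = f\<^sub>0"
      by blast
  qed
  show ?thesis
    unfolding star_def bij[symmetric] iff by auto
qed

lemma agree_to_sfun:
  assumes "f \<in> A \<rightarrow>\<^sub>E {1..q}" "g \<in> B \<rightarrow>\<^sub>E {1..q}"
  shows "agree {0<..} (to_sfun (A, f)) (to_sfun (B, g)) = {x \<in> A \<inter> B. f x = g x}"
  using assms by (fastforce simp: agree_def to_sfun_def PiE_iff split: if_splits)

context signed_range
begin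

text \<open>Undoing a flip changes the value prescribed at one element of the centre, so the
  conclusion needs an arbitrary \<open>c\<close> although the fully flipped families give a star
  with all prescribed values 1. The weight is the sum of the values.\<close>

lemma cross_bound:
  assumes m: "t \<le> m1" "m1 \<le> K" "t \<le> m2" "m2 \<le> K"
    and F: "F \<subseteq> sfuns {1..n} q m1" and G: "G \<subseteq> sfuns {1..n} q m2"
    and cross: "\<And>h g. h \<in> F \<Longrightarrow> g \<in> G \<Longrightarrow> t \<le> card (agree {0<..} h g)"
  shows "below m1 m2 F G \<or> (\<exists>X c. X \<subseteq> {1..n} \<and> card X = t \<and> c \<in> X \<rightarrow> {1..q} \<and>
    F = star n q m1 X c \<and> G = star n q m2 X c)"
proof -
  define \<sigma> :: "nat \<times> nat \<Rightarrow> (nat \<Rightarrow> nat) \<Rightarrow> nat \<Rightarrow> nat"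
    where "\<sigma> s h = flip (fst s) (snd s) h" for s h
  define mov :: "nat \<times> nat \<Rightarrow> (nat \<Rightarrow> nat) \<Rightarrow> bool"
    where "mov s h \<longleftrightarrow> h (fst s) = snd s" for s h
  \<comment> \<open>Positions outside \<open>{1..n}\<close> are harmless: the functions vanish
    there, whereas \<open>v\<close> is at least 2.\<close>
  define I where "I = {(x::nat, v). 2 \<le> v \<and> v \<le> q}"
  define w where "w h = sum h {1..n}" for h :: "nat \<Rightarrow> nat"
  define Q where "Q F G \<longleftrightarrow> F \<subseteq> sfuns {1..n} q m1 \<and> G \<subseteq> sfuns {1..n} q m2 \<and>
    (\<forall>h\<in>F. \<forall>g\<in>G. t \<le> card (agree {0<..} h g))" for F G
  have inv: "\<sigma> s (\<sigma> s h) = h" for s h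
    by (simp add: \<sigma>_def)
  have mov: "\<forall>h. mov s h \<longrightarrow> \<not> mov s (\<sigma> s h)" if "s \<in> I" for s
    using that by (auto simp: mov_def \<sigma>_def flip_def I_def)
  have adj: "t \<le> card (agree {0<..} (\<sigma> s h) g) \<longleftrightarrow> t \<le> card (agree {0<..} h (\<sigma> s g))"
    if "s \<in> I" for s h g
    using that by (auto simp: \<sigma>_def I_def agree_flip)
  have sf: "\<sigma> s h \<in> sfuns {1..n} q m" if "s \<in> I" "h \<in> sfuns {1..n} q m" for s h m
    using that by (auto simp: I_def \<sigma>_def intro!: sfuns_flip)
  have fin: "finite F \<and> finite G" if "Q F G" for F G
    using that card_sfuns finite_subset unfolding Q_def by (meson finite_atLeastAtMost)
  show ?thesis
  proof (rule shift_induct[where Q = Q and \<sigma> = \<sigma> and mov = mov and I = I and w = w])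
    show "Q F G"
      using F G cross by (auto simp: Q_def)
  next
    fix F G s h
    assume Q: "Q F G" and s: "s \<in> I" and h: "h \<in> F \<union> G" "mov s h"
    obtain x v where xv: "s = (x, v)" "2 \<le> v" "v \<le> q"
      using s by (auto simp: I_def)
    have "h x \<noteq> 0"
      using h(2) xv by (simp add: mov_def)
    then have x: "x \<in> {1..n}"
      using h(1) Q sfuns_support unfolding Q_def by blast
    have \<sigma>: "\<sigma> s h = h(x := 1)" "h x = v"
      using h(2) xv by (auto simp: \<sigma>_def mov_def flip_def)
    show "w (\<sigma> s h) < w h"
      unfolding w_def \<sigma>(1) by (rule sum_strict_mono_ex1) (use x \<sigma>(2) xv in auto)
  next
    fix F G s
    assume Q: "Q F G" and s: "s \<in> I"
    have cr: "t \<le> card (agree {0<..} h g)" if "h \<in> F" "g \<in> G" for h g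
      using that Q by (simp add: Q_def)
    have mono: "t \<le> card (agree {0<..} (\<sigma> s h) g)"
      if "mov s h" "\<not> mov s g" "h \<in> F \<union> G" "t \<le> card (agree {0<..} h g)" for h g
    proof -
      have "agree {0<..} h g \<subseteq> agree {0<..} (\<sigma> s h) g"
        using that s unfolding \<sigma>_def by (intro agree_flip_mono) (auto simp: I_def mov_def)
      moreover have "finite (agree {0<..} (\<sigma> s h) g)"
        using that(3) Q sf[OF s] unfolding Q_def by (blast intro: finite_agree)
      ultimately show ?thesis
        using that(4) card_mono le_trans by blast
    qed
    have "t \<le> card (agree {0<..} h g)" if "h \<in> shift (\<sigma> s) (mov s) F" "g \<in> shift (\<sigma> s) (mov s) G" for h g
    proof (rule shift_cross[where R = "\<lambda>h g. t \<le> card (agree {0<..} h g)",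
          OF cr inv[of s] adj[OF s] _ _ that])
      fix h g assume "h \<in> F" "g \<in> G" "\<not> mov s h" "mov s g" "t \<le> card (agree {0<..} h g)"
      then show "t \<le> card (agree {0<..} h (\<sigma> s g))"
        using mono[of g h] by (simp add: agree_commute)
    qed (use mono in auto)
    then show "Q (shift (\<sigma> s) (mov s) F) (shift (\<sigma> s) (mov s) G)"
      using Q shift_subset sf[OF s] unfolding Q_def by (metis (no_types, lifting))
  next
    fix F G s
    assume Q: "Q F G" and s: "s \<in> I"
      and concl: "below m1 m2 (shift (\<sigma> s) (mov s) F) (shift (\<sigma> s) (mov s) G) \<or>
        (\<exists>X c. X \<subseteq> {1..n} \<and> card X = t \<and> c \<in> X \<rightarrow> {1..q} \<and>
          shift (\<sigma> s) (mov s) F = star n q m1 X c \<and> shift (\<sigma> s) (mov s) G = star n q m2 X c)"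
    note finFG = conjunct1[OF fin[OF Q]] conjunct2[OF fin[OF Q]]
    have cr: "t \<le> card (agree {0<..} h g)" if "h \<in> F" "g \<in> G" for h g
      using that Q by (simp add: Q_def)
    obtain x v where xv: "s = (x, v)" "2 \<le> v" "v \<le> q"
      using s by (auto simp: I_def)
    show "below m1 m2 F G \<or> (\<exists>X c. X \<subseteq> {1..n} \<and> card X = t \<and> c \<in> X \<rightarrow> {1..q} \<and>
      F = star n q m1 X c \<and> G = star n q m2 X c)"
      using concl
    proof (elim disjE exE conjE)
      assume "below m1 m2 (shift (\<sigma> s) (mov s) F) (shift (\<sigma> s) (mov s) G)"
      then show ?thesis
        using card_shift[OF finFG(1) inv[of s]] card_shift[OF finFG(2) inv[of s]]
        by (simp add: below_def)
    next
      fix X c assume X: "X \<subseteq> {1..n}" "card X = t" and c: "c \<in> X \<rightarrow> {1..q}"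
        and S: "shift (\<sigma> s) (mov s) F = star n q m1 X c"
          "shift (\<sigma> s) (mov s) G = star n q m2 X c"
      show ?thesis
      \<comment> \<open>A flip to 1 at \<open>x\<close> can have created this star only if the star
        prescribes 1 there; otherwise it is closed under the reverse move.\<close>
      proof (cases "x \<in> X \<and> c x = 1")
        case False
        have "\<sigma> s h \<in> star n q m X c" if h: "h \<in> star n q m X c" "mov s (\<sigma> s h)" for h m
        proof -
          have "h x = 1"
            using h(2) xv by (auto simp: mov_def \<sigma>_def flip_def transpose_def split: if_splits)
          then have "x \<notin> X"
            using False h(1) by (auto simp: star_def)
          then show ?thesis
            using h(1) sf[OF s] xv(1) by (auto simp: star_def \<sigma>_def flip_def)
        qed
        then show ?thesis
          using shift_eq_trivial[OF finFG(1) inv[of s] mov[OF s] S(1)]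
            shift_eq_trivial[OF finFG(2) inv[of s] mov[OF s] S(2)] X c
          by blast
      next
        case True
        have av: "\<exists>g\<in>star n q m' X c. \<sigma> s g \<notin> star n q m' X c \<and>
            \<not> t \<le> card (agree {0<..} h1 (\<sigma> s g)) \<and> \<not> t \<le> card (agree {0<..} h2 (\<sigma> s g))"
          if m: "t \<le> m'" "m' \<le> K" "m \<le> K"
            and h: "h1 \<in> star n q m X c" "h2 \<in> star n q m X c" for m m' h1 h2
        proof -
          obtain g where g: "g \<in> star n q m' X c"
            "\<And>y. y \<notin> X \<Longrightarrow> g y \<noteq> 0 \<Longrightarrow> g y \<noteq> h1 y \<and> g y \<noteq> h2 y"
            using avoid[OF order_refl X _ c m(1,3,2) h] X(2) by auto
          have "\<sigma> s g \<notin> star n q m' X c"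
            using True xv g(1) by (auto simp: star_def \<sigma>_def flip_def)
          moreover have "\<not> t \<le> card (agree {0<..} h1 (\<sigma> s g))" "\<not> t \<le> card (agree {0<..} h2 (\<sigma> s g))"
            using flip_not_agree[OF X _ _ xv(2) _ g(1)] True h g(2) xv(1) by (auto simp: \<sigma>_def)
          ultimately show ?thesis
            using g(1) by blast
        qed
        have sg: "t \<le> card (agree {0<..} h g) \<longleftrightarrow> t \<le> card (agree {0<..} g h)" for h g
          by (simp add: agree_commute)
        have "F = star n q m1 X c \<and> G = star n q m2 X c \<or>
            F = \<sigma> s ` star n q m1 X c \<and> G = \<sigma> s ` star n q m2 X c"
        proof (rule shift_eq_back[where R = "\<lambda>h g. t \<le> card (agree {0<..} h g)",
              OF finFG inv[of s] mov[OF s] S cr adj[OF s]])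
          fix g assume "g \<in> star n q m2 X c"
          then obtain h where "h \<in> star n q m1 X c" "\<sigma> s h \<notin> star n q m1 X c"
            "\<not> t \<le> card (agree {0<..} g (\<sigma> s h))"
            using av[OF m(1,2,4)] by blast
          then show "\<exists>h\<in>star n q m1 X c. \<sigma> s h \<notin> star n q m1 X c \<and>
              \<not> t \<le> card (agree {0<..} h (\<sigma> s g))"
            using adj[OF s] sg by blast
        next
          fix h1 h2
          assume "h1 \<in> star n q m1 X c" "h2 \<in> star n q m1 X c"
          then show "\<exists>g\<in>star n q m2 X c. \<sigma> s g \<notin> star n q m2 X c \<and>
              \<not> t \<le> card (agree {0<..} h1 (\<sigma> s g)) \<and> \<not> t \<le> card (agree {0<..} h2 (\<sigma> s g))"
            by (rule av[OF m(3,4,2)])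
        qed
        moreover have "\<sigma> s ` star n q m X c = star n q m X (flip x v c)" for m
          using star_flip[of v q x X n m c] xv True by (simp add: \<sigma>_def)
        moreover have "flip x v c \<in> X \<rightarrow> {1..q}"
          using c xv True by (auto simp: flip_def)
        ultimately show ?thesis
          using X c by metis
      qed
    qed
  next
    fix F G
    assume Q: "Q F G" and st: "\<And>s h. s \<in> I \<Longrightarrow> h \<in> F \<Longrightarrow> mov s h \<Longrightarrow> \<sigma> s h \<in> F"
    have sub: "F \<subseteq> sfuns {1..n} q m1" "G \<subseteq> sfuns {1..n} q m2"
      using Q by (auto simp: Q_def)
    \<comment> \<open>Flips at distinct positions do not interfere, so closure under single flips
      lets any finite set of values \<ge> 2 be lowered to 1.\<close>
    have set_one: "(\<lambda>x. if x \<in> E then 1 else h x) \<in> F"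
      if "finite E" "h \<in> F" "E \<subseteq> {x. h x \<ge> 2}" for E h
      using that
    proof (induction E)
      case (insert x E)
      let ?h = "\<lambda>y. if y \<in> E then 1 else h y"
      have h: "?h \<in> F" "?h x = h x" "2 \<le> h x"
        using insert by auto
      have "h x \<le> q"
        using insert.prems(1) sub(1) sfuns_le by blast
      then have "\<sigma> (x, h x) ?h \<in> F"
        using h by (intro st) (auto simp: I_def mov_def)
      moreover have "\<sigma> (x, h x) ?h = (\<lambda>y. if y \<in> insert x E then 1 else h y)"
        using insert(2) by (auto simp: \<sigma>_def flip_def)
      ultimately show ?case
        by simp
    qed simp
    have "t \<le> card (agree {1} h g)" if hg: "h \<in> F" "g \<in> G" for h g
    proof -
      \<comment> \<open>Lowering \<open>h\<close> to 1 on \<open>?E\<close> while \<open>g\<close>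
        keeps its values destroys every agreement in a value \<ge> 2 and creates none. The cross
        condition for the lowered function therefore counts exactly the common ones of
        \<open>h\<close> and \<open>g\<close>.\<close>
      let ?E = "{x. h x = g x \<and> h x \<ge> 2}"
      have "finite {x. h x \<noteq> 0}"
        using hg(1) sub(1) finite_support by blast
      then have "finite ?E"
        by (rule finite_subset[rotated]) auto
      then have "(\<lambda>x. if x \<in> ?E then 1 else h x) \<in> F"
        using hg(1) by (rule set_one) auto
      then have "t \<le> card (agree {0<..} (\<lambda>x. if x \<in> ?E then 1 else h x) g)"
        using Q hg(2) unfolding Q_def by blast
      also have "agree {0<..} (\<lambda>x. if x \<in> ?E then 1 else h x) g = agree {1} h g"
        by (auto simp: agree_def split: if_splits)
      finally show ?thesis .
    qed
    then consider "below m1 m2 F G"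
      | X where "X \<subseteq> {1..n}" "card X = t" "F = star n q m1 X (\<lambda>_. 1)" "G = star n q m2 X (\<lambda>_. 1)"
      using cross_ones_bound[OF m sub] by blast
    then show "below m1 m2 F G \<or> (\<exists>X c. X \<subseteq> {1..n} \<and> card X = t \<and> c \<in> X \<rightarrow> {1..q} \<and>
      F = star n q m1 X c \<and> G = star n q m2 X c)"
    proof cases
      case (2 X)
      then show ?thesis
        using q_ge by (intro disjI2 exI[of _ X] exI[of _ "\<lambda>_. 1"]) simp
    qed blast
  qed (use fin inv in auto)
qed

lemma cross_t_intersecting_bound:
  assumes m: "t \<le> m1" "m1 \<le> K" "t \<le> m2" "m2 \<le> K"
    and F: "\<F> \<subseteq> signed_sets n m1 q" and G: "\<G> \<subseteq> signed_sets n m2 q"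
    and cross: "cross_t_intersecting t \<F> \<G>"
  defines "N \<equiv> (n - t choose (m1 - t)) * (n - t choose (m2 - t)) * q ^ (m1 + m2 - 2 * t)"
  shows "card \<F> * card \<G> \<le> N \<and> (card \<F> * card \<G> = N \<longleftrightarrow>
    (\<exists>X f\<^sub>0. X \<subseteq> {1..n} \<and> card X = t \<and> f\<^sub>0 \<in> X \<rightarrow>\<^sub>E {1..q} \<and>
      \<F> = {(A, f) \<in> signed_sets n m1 q. X \<subseteq> A \<and> restrict f X = f\<^sub>0} \<and>
      \<G> = {(B, g) \<in> signed_sets n m2 q. X \<subseteq> B \<and> restrict g X = f\<^sub>0}))"
proof -
  let ?S = "\<lambda>m X f\<^sub>0. {(A, f) \<in> signed_sets n m q. X \<subseteq> A \<and> restrict f X = f\<^sub>0}"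
  have bij: "to_sfun ` signed_sets n m q = sfuns {1..n} q m" "inj_on to_sfun (signed_sets n m q)" for m
    using bij_betw_to_sfun[of "{1..n}" m q] by (auto simp: bij_betw_def signed_sets_def)
  have card_image_eq: "card (to_sfun ` \<H>) = card \<H>" if "\<H> \<subseteq> signed_sets n m q" for \<H> m
    using inj_on_subset[OF bij(2) that] by (rule card_image)
  have Ssub: "?S m X f \<subseteq> signed_sets n m q" for m X f
    by blast
  have sub: "to_sfun ` \<F> \<subseteq> sfuns {1..n} q m1" "to_sfun ` \<G> \<subseteq> sfuns {1..n} q m2"
    using F G bij(1) by blast+
  have cr: "t \<le> card (agree {0<..} h g)" if "h \<in> to_sfun ` \<F>" "g \<in> to_sfun ` \<G>" for h g
  proof -
    obtain A f B g' where hg: "h = to_sfun (A, f)" "(A, f) \<in> \<F>" "g = to_sfun (B, g')" "(B, g') \<in> \<G>"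
      using \<open>h \<in> to_sfun ` \<F>\<close> \<open>g \<in> to_sfun ` \<G>\<close> by auto
    then have "t \<le> card {x \<in> A \<inter> B. f x = g' x}"
      using cross unfolding cross_t_intersecting_def by blast
    moreover have "f \<in> A \<rightarrow>\<^sub>E {1..q}" "g' \<in> B \<rightarrow>\<^sub>E {1..q}"
      using hg F G unfolding signed_sets_def by blast+
    ultimately show ?thesis
      using hg by (simp only: agree_to_sfun)
  qed
  have e: "m1 + m2 - 2 * t = (m1 - t) + (m2 - t)"
    using m by simp
  have N: "real N = star_size n q m1 t * star_size n q m2 t"
    unfolding N_def e power_add using m by (simp add: star_size_def)
  have full: "card \<F> * card \<G> = N"
    if X: "X \<subseteq> {1..n}" "card X = t" "f\<^sub>0 \<in> X \<rightarrow>\<^sub>E {1..q}" and eq: "\<F> = ?S m1 X f\<^sub>0" "\<G> = ?S m2 X f\<^sub>0" for X f\<^sub>0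
  proof -
    have "card (?S m X f\<^sub>0) = (n - t choose (m - t)) * q ^ (m - t)" if "t \<le> m" for m
      using card_image_eq[OF Ssub, of m X f\<^sub>0] set_to_sfun_star[OF X(3), of n m]
        card_star[OF X(1,2) that, of f\<^sub>0 q] X(3) by (simp add: PiE_iff Pi_iff)
    then show ?thesis
      unfolding eq N_def e power_add using m by simp
  qed
  consider "below m1 m2 (to_sfun ` \<F>) (to_sfun ` \<G>)"
    | X c where "X \<subseteq> {1..n}" "card X = t" "c \<in> X \<rightarrow> {1..q}"
      "to_sfun ` \<F> = star n q m1 X c" "to_sfun ` \<G> = star n q m2 X c"
    using cross_bound[OF m sub cr] by blast
  then show ?thesis
  proof cases
    case 1
    then have "real (card \<F> * card \<G>) < real N"
      using card_image_eq[OF F] card_image_eq[OF G] by (simp add: below_def N)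
    then have "card \<F> * card \<G> < N"
      by (simp only: of_nat_less_iff)
    \<comment> \<open>A pair of stars with a common centre would attain \<open>N\<close> by
      \<open>full\<close>, so both sides of the equivalence are false.\<close>
    then show ?thesis
      using full by fastforce
  next
    case (2 X c)
    \<comment> \<open>\<open>c\<close> is arbitrary outside \<open>X\<close>; its restriction is
      extensional and defines the same star.\<close>
    define f\<^sub>0 where "f\<^sub>0 = restrict c X"
    have f0: "f\<^sub>0 \<in> X \<rightarrow>\<^sub>E {1..q}"
      using 2(3) by (auto simp: f\<^sub>0_def)
    have "star n q m X c = star n q m X f\<^sub>0" for m
      by (auto simp: star_def f\<^sub>0_def)
    then have "to_sfun ` \<F> = to_sfun ` ?S m1 X f\<^sub>0" "to_sfun ` \<G> = to_sfun ` ?S m2 X f\<^sub>0"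
      using 2(4,5) set_to_sfun_star[OF f0] by simp_all
    then have eq: "\<F> = ?S m1 X f\<^sub>0" "\<G> = ?S m2 X f\<^sub>0"
      by (simp_all only: inj_on_image_eq_iff[OF bij(2) F Ssub] inj_on_image_eq_iff[OF bij(2) G Ssub])
    have "card \<F> * card \<G> = N"
      using full[OF 2(1,2) f0 eq] .
    moreover have "\<exists>X f\<^sub>0. X \<subseteq> {1..n} \<and> card X = t \<and> f\<^sub>0 \<in> X \<rightarrow>\<^sub>E {1..q} \<and>
        \<F> = ?S m1 X f\<^sub>0 \<and> \<G> = ?S m2 X f\<^sub>0"
      using 2(1,2) f0 eq by blast
    ultimately show ?thesis
      by simp
  qed
qed

end

theorem theorem5p1:
  fixes n k l t q :: nat
  assumes "n > k" and "k \<ge> l" and "l \<ge> t" and "t \<ge> 1" and "q \<ge> 2"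
  shows
    "(real n \<ge> real t + 2 * exp 1 * (real k - real t) * real k / real q \<longrightarrow>
       (\<forall>\<F>. \<F> \<subseteq> signed_sets n k q \<and> t_intersecting t \<F> \<longrightarrow>
          card \<F> \<le> ((n - t) choose (k - t)) * q ^ (k - t) \<and>
          (card \<F> = ((n - t) choose (k - t)) * q ^ (k - t) \<longleftrightarrow>
            (\<exists>X f\<^sub>0. X \<subseteq> {1..n} \<and> card X = t \<and> f\<^sub>0 \<in> X \<rightarrow>\<^sub>E {1..q} \<and>
               \<F> = {(A, f) \<in> signed_sets n k q. X \<subseteq> A \<and> restrict f X = f\<^sub>0}))))
     \<and>
     (real n \<ge> real t + 2 * exp 1 * max ((real t + 2)\<^sup>2 * (real k - real t)) ((real k)\<^sup>2) / real q \<longrightarrow>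
       (\<forall>\<F> \<G>. \<F> \<subseteq> signed_sets n k q \<and> \<G> \<subseteq> signed_sets n l q \<and> cross_t_intersecting t \<F> \<G> \<longrightarrow>
          card \<F> * card \<G> \<le>
            ((n - t) choose (k - t)) * ((n - t) choose (l - t)) * q ^ (k + l - 2 * t) \<and>
          (card \<F> * card \<G> =
            ((n - t) choose (k - t)) * ((n - t) choose (l - t)) * q ^ (k + l - 2 * t) \<longleftrightarrow>
            (\<exists>X f\<^sub>0. X \<subseteq> {1..n} \<and> card X = t \<and> f\<^sub>0 \<in> X \<rightarrow>\<^sub>E {1..q} \<and>
               \<F> = {(A, f) \<in> signed_sets n k q. X \<subseteq> A \<and> restrict f X = f\<^sub>0} \<and>
               \<G> = {(B, g) \<in> signed_sets n l q. X \<subseteq> B \<and> restrict g X = f\<^sub>0}))))"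
proof (intro conjI impI allI; (elim conjE)?)
  have range: "signed_range n q t k"
    if "real t + 2 * exp 1 * (real k - real t) * real k / real q \<le> real n"
  proof
    have "2 * exp 1 * (real k - real t) * real k / real q \<le> real n - real t"
      using that by simp
    then show "2 * exp 1 * (real k - real t) * real k \<le> (real n - real t) * real q"
      using assms by (simp add: pos_divide_le_eq)
  qed (use assms in auto)
  {
    fix \<F>
    assume "real t + 2 * exp 1 * (real k - real t) * real k / real q \<le> real n"
      and F: "\<F> \<subseteq> signed_sets n k q" "t_intersecting t \<F>"
    then interpret signed_range n q t k
      using range by blast
    \<comment> \<open>Being \<open>t\<close>-intersecting is the cross condition of the family with
      itself. The product bound is then the square of \<open>B\<close>, and both the bound and its
      equality case pass to square roots.\<close>
    define B where "B = (n - t choose (k - t)) * q ^ (k - t)"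
    have "k + k - 2 * t = (k - t) + (k - t)"
      using assms by simp
    then have B2: "(n - t choose (k - t)) * (n - t choose (k - t)) * q ^ (k + k - 2 * t) = B * B"
      by (simp add: B_def power_add)
    have kt: "t \<le> k" "k \<le> k"
      using assms by auto
    have cross: "cross_t_intersecting t \<F> \<F>"
      using F(2) unfolding t_intersecting_def cross_t_intersecting_def .
    note main = cross_t_intersecting_bound[OF kt kt F(1) F(1) cross, unfolded B2]
    have sq: "card \<F> * card \<F> = B * B \<longleftrightarrow> card \<F> = B" "card \<F> * card \<F> \<le> B * B \<longleftrightarrow> card \<F> \<le> B"
      by (simp_all flip: power2_eq_square)
    show "card \<F> \<le> (n - t choose (k - t)) * q ^ (k - t)"
      and "card \<F> = (n - t choose (k - t)) * q ^ (k - t) \<longleftrightarrow>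
        (\<exists>X f\<^sub>0. X \<subseteq> {1..n} \<and> card X = t \<and> f\<^sub>0 \<in> X \<rightarrow>\<^sub>E {1..q} \<and>
          \<F> = {(A, f) \<in> signed_sets n k q. X \<subseteq> A \<and> restrict f X = f\<^sub>0})"
      using main unfolding sq B_def[symmetric] by simp_all
  }
  {
    fix \<F> \<G>
    assume n: "real t + 2 * exp 1 * max ((real t + 2)\<^sup>2 * (real k - real t)) ((real k)\<^sup>2) / real q \<le> real n"
      and FG: "\<F> \<subseteq> signed_sets n k q" "\<G> \<subseteq> signed_sets n l q" "cross_t_intersecting t \<F> \<G>"
    have "(real k - real t) * real k \<le> (real k)\<^sup>2"
      unfolding power2_eq_square by (intro mult_right_mono) auto
    also have "\<dots> \<le> max ((real t + 2)\<^sup>2 * (real k - real t)) ((real k)\<^sup>2)"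
      by simp
    finally have "2 * exp 1 * ((real k - real t) * real k) / real q \<le>
        2 * exp 1 * max ((real t + 2)\<^sup>2 * (real k - real t)) ((real k)\<^sup>2) / real q"
      by (intro divide_right_mono mult_left_mono) auto
    then have "real t + 2 * exp 1 * (real k - real t) * real k / real q \<le> real n"
      using n by (simp only: mult.assoc)
    then interpret signed_range n q t k
      using range by blast
    have kl: "t \<le> k" "k \<le> k" "t \<le> l" "l \<le> k"
      using assms by auto
    note main = cross_t_intersecting_bound[OF kl FG]
    show "card \<F> * card \<G> \<le>
        (n - t choose (k - t)) * (n - t choose (l - t)) * q ^ (k + l - 2 * t)"
      and "card \<F> * card \<G> =
        (n - t choose (k - t)) * (n - t choose (l - t)) * q ^ (k + l - 2 * t) \<longleftrightarrow>
        (\<exists>X f\<^sub>0. X \<subseteq> {1..n} \<and> card X = t \<and> f\<^sub>0 \<in> X \<rightarrow>\<^sub>E {1..q} \<and>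
          \<F> = {(A, f) \<in> signed_sets n k q. X \<subseteq> A \<and> restrict f X = f\<^sub>0} \<and>
          \<G> = {(B, g) \<in> signed_sets n l q. X \<subseteq> B \<and> restrict g X = f\<^sub>0})"
      using main by simp_all
  }
qed

end
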